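(* Let $t$ be a quasi-homogeneous holomorphic curve with associated bundle $E_t$. Then $K^0(E_t)\cong K_0(\mathcal A'(E_t))$.
   Context: $\mathbb D$ is the open unit disc. For $\lambda>0$, $\mathbb A^{(\lambda)}(\mathbb D)$ is the Hilbert space of holomorphic functions on $\mathbb D$ with reproducing kernel $(1-z\bar w)^{-\lambda}$. $B_n(\mathbb D)$ is the Cowen–Douglas class: bounded operators $T$ on a separable Hilbert space such that for each $w\in\mathbb D$, $T-w$ is surjective and $\dim\ker(T-w)=n$, and the subspaces $\ker(T-w)$ span a dense subspace. A quasi-homogeneous holomorphic curve $t$ of rank $n\ge2$ is given by: $\lambda_0>0$, a valency $\Lambda(t)>0$, $\lambda_i=\lambda_0+i\Lambda(t)$, and complex constants $\mu_{i,j}$ ($0\le i\le j\le n-1$) with $\mu_{i,i}=1$ and $\mu_{i,i+1}\ne0$. Put $\mathcal H_i=\mathbb A^{(\lambda_i)}(\mathbb D)$, $\mathcal H=\mathcal H_0\oplus\cdots\oplus\mathcal H_{n-1}$, atoms $t_i(w)(z)=(1-zw)^{-\lambda_i}\in\mathcal H_i$, frame $\gamma_j(w)=\sum_{i=0}^j\mu_{i,j}t_i^{(j-i)}(w)$ (derivatives in $w$), $t(w)=\mathrm{span}\{\gamma_0(w),\dots,\gamma_{n-1}(w)\}$; $E_t$ is the Hermitian holomorphic bundle over $\mathbb D$ with fibre $t(w)$. Standing assumption: the linear transformation $T$ with $T\gamma_j(w)=w\gamma_j(w)$ extends to a bounded operator on $\mathcal H$ belonging to $B_n(\mathbb D)$.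 For a holomorphic curve $t$ in $\mathcal H$, $\mathcal A'(E_t)=\{A\in\mathcal L(\mathcal H):A\,t(w)\subseteq t(w),\ w\in\mathbb D\}$. For $m\ge1$, $t^m$ denotes the $m$-fold direct sum of $t$ (a curve in $\mathcal H^{(m)}$), so that $\mathcal A'(E_{t^m})=M_m(\mathcal A'(E_t))$. $K_0(\mathcal A'(E_t))$ is the algebraic $K_0$-group: the Grothendieck group of the abelian semigroup $\mathrm{Vect}(\mathcal A'(E_t))$ of algebraic equivalence classes of idempotents in $M_\infty(\mathcal A'(E_t))=\bigcup_k M_k(\mathcal A'(E_t))$, under direct sum. $K^0(E_t)$ is defined as follows. A sub-bundle of $E_{t^m}$ means a bundle of the form $PE_{t^m}$ (fibres $P\,t^m(w)$) with $P\in\mathcal A'(E_{t^m})$ idempotent. A sub-bundle of $E_{t^k}$ is regarded as a sub-bundle of $E_{t^m}$ for $m>k$. Two sub-bundles $E_r$, $E_s$ (regarded as sub-bundles of a common $E_{t^m}$) are similar if there is an invertible $X\in\mathcal A'(E_{t^m})$ with $XE_r=E_s$. $\mathrm{Vect}^0(E_t)$ is the set of equivalence classes $\overline{E_s}$ of sub-bundles $E_s$ of $E_{t^m}$, $m=1,2,\dots$, with addition $\overline{E_r}+\overline{E_s}=\overline{E_r\oplus E_s}$, and $K^0(E_t)$ is the Grothendieck group of $(\mathrm{Vect}^0(E_t),+)$. *)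

theory Defs
  imports
    "HOL-Analysis.Analysis"
    "HOL-Algebra.Ring"
    "HOL-Library.Function_Algebras"
begin

abbreviation unit_disc :: "complex set" where
  "unit_disc \<equiv> ball 0 1"

section \<open>Hilbert spaces of complex-valued functions\<close>

text \<open>All vectors are functions \<open>'x \<Rightarrow> complex\<close> with pointwise operations, so that complex
  linear span and dimension are the library notions of \<^locale>\<open>vector_space\<close>.\<close>

definition fscale :: "complex \<Rightarrow> ('x \<Rightarrow> complex) \<Rightarrow> 'x \<Rightarrow> complex" where
  "fscale c f = (\<lambda>x. c * f x)"

global_interpretation cfun: vector_space "fscale :: complex \<Rightarrow> ('x \<Rightarrow> complex) \<Rightarrow> 'x \<Rightarrow> complex"
  by unfold_locales (auto simp: fscale_def fun_eq_iff algebra_simps)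

record 'x hspace =
  vec :: "('x \<Rightarrow> complex) set"
  ip :: "('x \<Rightarrow> complex) \<Rightarrow> ('x \<Rightarrow> complex) \<Rightarrow> complex"

definition hnorm :: "'x hspace \<Rightarrow> ('x \<Rightarrow> complex) \<Rightarrow> real" where
  "hnorm H v = sqrt (Re (ip H v v))"

locale chilbert_space =
  fixes H :: "'x hspace"
  assumes subspace_vec: "cfun.subspace (vec H)"
    and ip_add: "\<lbrakk>u \<in> vec H; v \<in> vec H; x \<in> vec H\<rbrakk> \<Longrightarrow> ip H (u + v) x = ip H u x + ip H v x"
    and ip_scale: "\<lbrakk>u \<in> vec H; v \<in> vec H\<rbrakk> \<Longrightarrow> ip H (fscale c u) v = c * ip H u v"
    and ip_cnj: "\<lbrakk>u \<in> vec H; v \<in> vec H\<rbrakk> \<Longrightarrow> ip H v u = cnj (ip H u v)"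
    and ip_pos: "\<lbrakk>v \<in> vec H; v \<noteq> 0\<rbrakk> \<Longrightarrow> Re (ip H v v) > 0"
    and complete: "\<lbrakk>\<And>k. X k \<in> vec H;
        \<And>e. e > 0 \<Longrightarrow> \<exists>N. \<forall>i\<ge>N. \<forall>j\<ge>N. hnorm H (X i - X j) < e\<rbrakk>
      \<Longrightarrow> \<exists>l\<in>vec H. (\<lambda>k. hnorm H (X k - l)) \<longlonglongrightarrow> 0"

definition dense_in :: "'x hspace \<Rightarrow> ('x \<Rightarrow> complex) set \<Rightarrow> bool" where
  "dense_in H S \<longleftrightarrow> S \<subseteq> vec H \<and> (\<forall>v\<in>vec H. \<forall>e>0. \<exists>u\<in>S. hnorm H (v - u) < e)"

definition separable :: "'x hspace \<Rightarrow> bool" where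
  "separable H \<longleftrightarrow> (\<exists>S. countable S \<and> dense_in H S)"

text \<open>A vector of a direct sum is a function of the index of the summand and of the argument; it
  vanishes at all indices beyond the number of summands. Hence \<open>dsum_space k (\<lambda>_. H)\<close> is literally
  contained in \<open>dsum_space m (\<lambda>_. H)\<close> for \<open>k \<le> m\<close>.\<close>

definition dsum_space :: "nat \<Rightarrow> (nat \<Rightarrow> 'x hspace) \<Rightarrow> (nat \<times> 'x) hspace" where
  "dsum_space n Hs =
    \<lparr> vec = {F. (\<forall>i<n. curry F i \<in> vec (Hs i)) \<and> (\<forall>i\<ge>n. curry F i = 0)},
      ip = (\<lambda>F G. \<Sum>i<n. ip (Hs i) (curry F i) (curry G i)) \<rparr>"

definition in_summand :: "nat \<Rightarrow> ('x \<Rightarrow> complex) \<Rightarrow> nat \<times> 'x \<Rightarrow> complex" where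
  "in_summand i f = (\<lambda>(k, x). if k = i then f x else 0)"

section \<open>Bounded operators and the Cowen--Douglas class\<close>

text \<open>Operators are extensional functions, so that equality of operators is equality in HOL.\<close>

definition bounded_ops :: "'x hspace \<Rightarrow> (('x \<Rightarrow> complex) \<Rightarrow> ('x \<Rightarrow> complex)) set" where
  "bounded_ops H = {A \<in> vec H \<rightarrow>\<^sub>E vec H.
     (\<forall>u\<in>vec H. \<forall>v\<in>vec H. A (u + v) = A u + A v) \<and>
     (\<forall>c. \<forall>v\<in>vec H. A (fscale c v) = fscale c (A v)) \<and>
     (\<exists>C. \<forall>v\<in>vec H. hnorm H (A v) \<le> C * hnorm H v)}"

definition eigenspace ::
  "'x hspace \<Rightarrow> (('x \<Rightarrow> complex) \<Rightarrow> ('x \<Rightarrow> complex)) \<Rightarrow> complex \<Rightarrow> ('x \<Rightarrow> complex) set" where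
  "eigenspace H T w = {v \<in> vec H. T v = fscale w v}"

text \<open>The library dimension of an infinite-dimensional space is 0, which is why \<open>n \<ge> 1\<close> is
  demanded.\<close>

definition cowen_douglas ::
  "nat \<Rightarrow> 'x hspace \<Rightarrow> (('x \<Rightarrow> complex) \<Rightarrow> ('x \<Rightarrow> complex)) \<Rightarrow> bool" where
  "cowen_douglas n H T \<longleftrightarrow>
     n \<ge> 1 \<and> chilbert_space H \<and> separable H \<and> T \<in> bounded_ops H \<and>
     (\<forall>w\<in>unit_disc. (\<lambda>v. T v - fscale w v) ` vec H = vec H) \<and>
     (\<forall>w\<in>unit_disc. cfun.dim (eigenspace H T w) = n) \<and>
     dense_in H (cfun.span (\<Union>w\<in>unit_disc. eigenspace H T w))"

section \<open>Quasi-homogeneous holomorphic curves\<close>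

text \<open>Functions on the disc are extended by 0 to all of \<open>complex\<close>. By uniqueness of reproducing
  kernel Hilbert spaces, the following locale determines \<^term>\<open>vec H\<close>, and \<^term>\<open>ip H\<close> on it. In
  the powers below the base has positive real part, so the principal branch is the usual one.\<close>

locale bergman_space = chilbert_space H for H :: "complex hspace" +
  fixes l :: real
  assumes holomorphic: "f \<in> vec H \<Longrightarrow> f holomorphic_on unit_disc"
    and outside: "\<lbrakk>f \<in> vec H; z \<notin> unit_disc\<rbrakk> \<Longrightarrow> f z = 0"
    and kernel_in: "w \<in> unit_disc \<Longrightarrow>
      (\<lambda>z. if z \<in> unit_disc then (1 - z * cnj w) powr (- complex_of_real l) else 0) \<in> vec H"
    and reproducing: "\<lbrakk>f \<in> vec H; w \<in> unit_disc\<rbrakk> \<Longrightarrow>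
      ip H f (\<lambda>z. if z \<in> unit_disc then (1 - z * cnj w) powr (- complex_of_real l) else 0) = f w"

definition atom :: "real \<Rightarrow> complex \<Rightarrow> complex \<Rightarrow> complex" where
  "atom l w = (\<lambda>z. if z \<in> unit_disc then (1 - z * w) powr (- complex_of_real l) else 0)"

definition atom_deriv :: "nat \<Rightarrow> real \<Rightarrow> complex \<Rightarrow> complex \<Rightarrow> complex" where
  "atom_deriv k l w = (\<lambda>z. (deriv ^^ k) (\<lambda>u. atom l u z) w)"

definition qh_frame ::
  "real \<Rightarrow> real \<Rightarrow> (nat \<Rightarrow> nat \<Rightarrow> complex) \<Rightarrow> nat \<Rightarrow> complex \<Rightarrow> nat \<times> complex \<Rightarrow> complex" where
  "qh_frame l0 L \<mu> j w =
     (\<Sum>i\<le>j. fscale (\<mu> i j) (in_summand i (atom_deriv (j - i) (l0 + real i * L) w)))"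

definition qh_curve ::
  "nat \<Rightarrow> real \<Rightarrow> real \<Rightarrow> (nat \<Rightarrow> nat \<Rightarrow> complex) \<Rightarrow> complex \<Rightarrow> (nat \<times> complex \<Rightarrow> complex) set" where
  "qh_curve n l0 L \<mu> w = cfun.span ((\<lambda>j. qh_frame l0 L \<mu> j w) ` {..<n})"

section \<open>The Grothendieck group of an abelian semigroup\<close>

definition grothendieck_rel :: "'a set \<Rightarrow> ('a \<Rightarrow> 'a \<Rightarrow> 'a) \<Rightarrow> (('a \<times> 'a) \<times> ('a \<times> 'a)) set" where
  "grothendieck_rel S pl = {((a, b), (c, d)). a \<in> S \<and> b \<in> S \<and> c \<in> S \<and> d \<in> S \<and>
     (\<exists>e\<in>S. pl (pl a d) e = pl (pl c b) e)}"

definition grothendieck_group :: "'a set \<Rightarrow> ('a \<Rightarrow> 'a \<Rightarrow> 'a) \<Rightarrow> ('a \<times> 'a) set monoid" where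
  "grothendieck_group S pl =
    \<lparr> carrier = (S \<times> S) // grothendieck_rel S pl,
      mult = (\<lambda>X Y. \<Union>(a, b)\<in>X. \<Union>(c, d)\<in>Y. grothendieck_rel S pl `` {(pl a c, pl b d)}),
      one = (\<Union>a\<in>S. grothendieck_rel S pl `` {(a, a)}) \<rparr>"

section \<open>The algebraic K-group of a ring\<close>

text \<open>A \<open>k \<times> k\<close> matrix is padded with zeros to an infinite one, so that the embeddings
  \<open>a \<mapsto> diag(a, 0)\<close> become inclusions.\<close>

definition matrices :: "('a, 'b) ring_scheme \<Rightarrow> nat \<Rightarrow> (nat \<Rightarrow> nat \<Rightarrow> 'a) set" where
  "matrices R k = {a. (\<forall>i j. a i j \<in> carrier R) \<and> (\<forall>i j. i \<ge> k \<or> j \<ge> k \<longrightarrow> a i j = \<zero>\<^bsub>R\<^esub>)}"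

definition matrices_inf :: "('a, 'b) ring_scheme \<Rightarrow> (nat \<Rightarrow> nat \<Rightarrow> 'a) set" where
  "matrices_inf R = (\<Union>k. matrices R k)"

definition mat_mult ::
  "('a, 'b) ring_scheme \<Rightarrow> (nat \<Rightarrow> nat \<Rightarrow> 'a) \<Rightarrow> (nat \<Rightarrow> nat \<Rightarrow> 'a) \<Rightarrow> nat \<Rightarrow> nat \<Rightarrow> 'a" where
  "mat_mult R a b = (\<lambda>i j. \<Oplus>\<^bsub>R\<^esub>l\<in>{l. a i l \<noteq> \<zero>\<^bsub>R\<^esub>}. a i l \<otimes>\<^bsub>R\<^esub> b l j)"

definition idempotents :: "('a, 'b) ring_scheme \<Rightarrow> (nat \<Rightarrow> nat \<Rightarrow> 'a) set" where
  "idempotents R = {p \<in> matrices_inf R. mat_mult R p p = p}"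

definition alg_equiv :: "('a, 'b) ring_scheme \<Rightarrow> ((nat \<Rightarrow> nat \<Rightarrow> 'a) \<times> (nat \<Rightarrow> nat \<Rightarrow> 'a)) set" where
  "alg_equiv R = {(p, q). p \<in> idempotents R \<and> q \<in> idempotents R \<and>
     (\<exists>x\<in>matrices_inf R. \<exists>y\<in>matrices_inf R. mat_mult R x y = p \<and> mat_mult R y x = q)}"

definition Vect :: "('a, 'b) ring_scheme \<Rightarrow> (nat \<Rightarrow> nat \<Rightarrow> 'a) set set" where
  "Vect R = idempotents R // alg_equiv R"

text \<open>\<open>diag_sum R k p q\<close> is \<open>diag(p, q)\<close> with \<open>p\<close> regarded as a \<open>k \<times> k\<close> matrix.\<close>

definition diag_sum ::
  "('a, 'b) ring_scheme \<Rightarrow> nat \<Rightarrow> (nat \<Rightarrow> nat \<Rightarrow> 'a) \<Rightarrow> (nat \<Rightarrow> nat \<Rightarrow> 'a) \<Rightarrow> nat \<Rightarrow> nat \<Rightarrow> 'a" where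
  "diag_sum R k p q = (\<lambda>i j.
     if i < k \<and> j < k then p i j
     else if i \<ge> k \<and> j \<ge> k then q (i - k) (j - k)
     else \<zero>\<^bsub>R\<^esub>)"

text \<open>The class of \<open>diag_sum R k p q\<close> depends neither on the representatives nor on \<open>k\<close>, so the
  union below is over a single class.\<close>

definition Vect_add ::
  "('a, 'b) ring_scheme \<Rightarrow> (nat \<Rightarrow> nat \<Rightarrow> 'a) set \<Rightarrow> (nat \<Rightarrow> nat \<Rightarrow> 'a) set \<Rightarrow> (nat \<Rightarrow> nat \<Rightarrow> 'a) set" where
  "Vect_add R X Y =
     (\<Union>p\<in>X. \<Union>q\<in>Y. \<Union>k\<in>{k. p \<in> matrices R k}. alg_equiv R `` {diag_sum R k p q})"

definition K0_ring ::
  "('a, 'b) ring_scheme \<Rightarrow> ((nat \<Rightarrow> nat \<Rightarrow> 'a) set \<times> (nat \<Rightarrow> nat \<Rightarrow> 'a) set) set monoid" where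
  "K0_ring R = grothendieck_group (Vect R) (Vect_add R)"

section \<open>The algebra of a curve and the K-group of its bundle\<close>

text \<open>A curve is given by its fibres: a function from the disc to subspaces of \<^term>\<open>vec H\<close>.\<close>

definition curve_algebra ::
  "'x hspace \<Rightarrow> (complex \<Rightarrow> ('x \<Rightarrow> complex) set) \<Rightarrow> (('x \<Rightarrow> complex) \<Rightarrow> ('x \<Rightarrow> complex)) ring" where
  "curve_algebra H t =
    \<lparr> carrier = {A \<in> bounded_ops H. \<forall>w\<in>unit_disc. A ` t w \<subseteq> t w},
      mult = compose (vec H),
      one = (\<lambda>v\<in>vec H. v),
      zero = (\<lambda>v\<in>vec H. 0),
      add = (\<lambda>A B. \<lambda>v\<in>vec H. A v + B v) \<rparr>"

definition curve_power ::
  "nat \<Rightarrow> (complex \<Rightarrow> ('x \<Rightarrow> complex) set) \<Rightarrow> complex \<Rightarrow> (nat \<times> 'x \<Rightarrow> complex) set" where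
  "curve_power m t w = {F. (\<forall>i<m. curry F i \<in> t w) \<and> (\<forall>i\<ge>m. curry F i = 0)}"

abbreviation power_algebra ::
  "'x hspace \<Rightarrow> (complex \<Rightarrow> ('x \<Rightarrow> complex) set) \<Rightarrow> nat
    \<Rightarrow> ((nat \<times> 'x \<Rightarrow> complex) \<Rightarrow> (nat \<times> 'x \<Rightarrow> complex)) ring" where
  "power_algebra H t m \<equiv> curve_algebra (dsum_space m (\<lambda>_. H)) (curve_power m t)"

text \<open>A sub-bundle is identified with its family of fibres over the disc. Because of the encoding
  of direct sums, a sub-bundle of the \<open>k\<close>-th power is one of every higher power.\<close>

definition subbundles ::
  "'x hspace \<Rightarrow> (complex \<Rightarrow> ('x \<Rightarrow> complex) set) \<Rightarrow> nat
    \<Rightarrow> (complex \<Rightarrow> (nat \<times> 'x \<Rightarrow> complex) set) set" where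
  "subbundles H t m = {(\<lambda>w\<in>unit_disc. P ` curve_power m t w) | P.
     P \<in> carrier (power_algebra H t m) \<and> P \<otimes>\<^bsub>power_algebra H t m\<^esub> P = P}"

definition subbundles_inf ::
  "'x hspace \<Rightarrow> (complex \<Rightarrow> ('x \<Rightarrow> complex) set) \<Rightarrow> (complex \<Rightarrow> (nat \<times> 'x \<Rightarrow> complex) set) set" where
  "subbundles_inf H t = (\<Union>m\<in>{1..}. subbundles H t m)"

definition bundle_similar ::
  "'x hspace \<Rightarrow> (complex \<Rightarrow> ('x \<Rightarrow> complex) set)
    \<Rightarrow> ((complex \<Rightarrow> (nat \<times> 'x \<Rightarrow> complex) set) \<times> (complex \<Rightarrow> (nat \<times> 'x \<Rightarrow> complex) set)) set" where
  "bundle_similar H t = {(E, F). \<exists>m\<ge>1. E \<in> subbundles H t m \<and> F \<in> subbundles H t m \<and>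
     (\<exists>X\<in>Units (power_algebra H t m). \<forall>w\<in>unit_disc. X ` E w = F w)}"

definition Vect0 ::
  "'x hspace \<Rightarrow> (complex \<Rightarrow> ('x \<Rightarrow> complex) set) \<Rightarrow> (complex \<Rightarrow> (nat \<times> 'x \<Rightarrow> complex) set) set set" where
  "Vect0 H t = subbundles_inf H t // bundle_similar H t"

definition shift_summands :: "nat \<Rightarrow> (nat \<times> 'x \<Rightarrow> complex) \<Rightarrow> nat \<times> 'x \<Rightarrow> complex" where
  "shift_summands k F = (\<lambda>(i, x). if i < k then 0 else F (i - k, x))"

text \<open>The direct sum of \<open>E\<close>, regarded as a sub-bundle of the \<open>k\<close>-th power, and \<open>F\<close>.\<close>

definition bundle_sum ::
  "nat \<Rightarrow> (complex \<Rightarrow> (nat \<times> 'x \<Rightarrow> complex) set) \<Rightarrow> (complex \<Rightarrow> (nat \<times> 'x \<Rightarrow> complex) set)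
    \<Rightarrow> complex \<Rightarrow> (nat \<times> 'x \<Rightarrow> complex) set" where
  "bundle_sum k E F = (\<lambda>w\<in>unit_disc. {u + shift_summands k v | u v. u \<in> E w \<and> v \<in> F w})"

text \<open>As for idempotents, the class of the sum depends neither on the representatives nor on
  \<open>k\<close>.\<close>

definition Vect0_add ::
  "'x hspace \<Rightarrow> (complex \<Rightarrow> ('x \<Rightarrow> complex) set)
    \<Rightarrow> (complex \<Rightarrow> (nat \<times> 'x \<Rightarrow> complex) set) set \<Rightarrow> (complex \<Rightarrow> (nat \<times> 'x \<Rightarrow> complex) set) set
    \<Rightarrow> (complex \<Rightarrow> (nat \<times> 'x \<Rightarrow> complex) set) set" where
  "Vect0_add H t X Y =
     (\<Union>E\<in>X. \<Union>F\<in>Y. \<Union>k\<in>{k. k \<ge> 1 \<and> E \<in> subbundles H t k}. bundle_similar H t `` {bundle_sum k E F})"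

definition K0_bundle ::
  "'x hspace \<Rightarrow> (complex \<Rightarrow> ('x \<Rightarrow> complex) set)
    \<Rightarrow> ((complex \<Rightarrow> (nat \<times> 'x \<Rightarrow> complex) set) set \<times> (complex \<Rightarrow> (nat \<times> 'x \<Rightarrow> complex) set) set) set monoid" where
  "K0_bundle H t = grothendieck_group (Vect0 H t) (Vect0_add H t)"

end

theory Submission
  imports Defs
begin

text \<open>An idempotent matrix \<open>p\<close> over \<open>\<A>'(E\<^sub>t)\<close> acts on the fibres of the powers of \<open>t\<close>, and its ranges
  there form a sub-bundle, the range bundle of \<open>p\<close>. The theorem holds because \<open>p \<mapsto> range bundle of p\<close>
  is onto the sub-bundles, carries diagonal sums to direct sums, and turns algebraic equivalence of
  idempotents into similarity of sub-bundles, in both directions. It therefore induces an isomorphism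
  from the semigroup \<open>Vect\<close> to \<open>Vect\<^sup>0\<close>, and isomorphic semigroups have isomorphic Grothendieck groups
  (\<open>grothendieck_group_cong\<close>).

  The sub-bundle remembers enough of \<open>p\<close> because the fibres \<open>t w\<close> span a dense subspace: a bounded
  operator is determined by its values on the fibres (\<open>R_eqI_fibres\<close>). If \<open>p\<close> and \<open>q\<close> have the same range
  bundle, then \<open>p q = q\<close> and \<open>q p = p\<close> on all fibres, hence as matrices, so that \<open>p\<close> and \<open>q\<close> are
  equivalent. If an invertible \<open>X\<close> carries one range bundle to the other, the same argument applies to
  \<open>X p X\<^sup>-\<^sup>1\<close> and \<open>q\<close> (\<open>similar_imp_alg_equiv\<close>). Conversely, if \<open>p = x y\<close> and \<open>q = y x\<close>, then \<open>p\<close> and \<open>q\<close>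
  need not be conjugate in the size in which they are given, but they are after doubling it: a
  \<open>2 \<times> 2\<close> block matrix with entries \<open>y\<close>, \<open>1 - q\<close>, \<open>1 - p\<close>, \<open>x\<close> is invertible and maps the range bundle
  of \<open>p\<close> onto that of \<open>q\<close> (\<open>alg_equiv_imp_similar\<close>).

  All of this works for any family of subspaces of a Hilbert space with dense span, the setting of the
  locale \<open>spanning_curve\<close>. A quasi-homogeneous curve is of this kind: the \<open>n\<close> vectors of the frame at
  \<open>w\<close> are linearly independent, because the frame is triangular with respect to the summands, and they
  are eigenvectors of \<open>T\<close>. Since \<open>T\<close> is in the Cowen--Douglas class, its eigenspace at \<open>w\<close> has dimension
  \<open>n\<close> and thus equals the fibre, and the eigenspaces have dense span.\<close>

section \<open>Grothendieck groups of isomorphic semigroups\<close>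

text \<open>Relation, carrier and product of the Grothendieck group are all defined from the addition of the
  semigroup alone, so that a bijective homomorphism carries each of them over.\<close>

lemma grothendieck_group_cong:
  assumes bij: "bij_betw \<phi> S S'"
    and closed: "\<And>a b. a \<in> S \<Longrightarrow> b \<in> S \<Longrightarrow> pl a b \<in> S"
    and add: "\<And>a b. a \<in> S \<Longrightarrow> b \<in> S \<Longrightarrow> \<phi> (pl a b) = pl' (\<phi> a) (\<phi> b)"
  shows "grothendieck_group S pl \<cong> grothendieck_group S' pl'"
proof -
  define \<Phi> where "\<Phi> = map_prod \<phi> \<phi>"
  let ?r = "grothendieck_rel S pl" and ?r' = "grothendieck_rel S' pl'"
  have inj: "inj_on \<phi> S" and img: "S' = \<phi> ` S"
    using bij by (auto simp: bij_betw_def)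
  have rel: "((\<phi> a, \<phi> b), (\<phi> c, \<phi> d)) \<in> ?r' \<longleftrightarrow> ((a, b), (c, d)) \<in> ?r"
    if "a \<in> S" "b \<in> S" "c \<in> S" "d \<in> S" for a b c d
  proof -
    have "pl' (pl' (\<phi> a) (\<phi> d)) (\<phi> e) = pl' (pl' (\<phi> c) (\<phi> b)) (\<phi> e)
        \<longleftrightarrow> pl (pl a d) e = pl (pl c b) e" if "e \<in> S" for e
      using that \<open>a \<in> S\<close> \<open>b \<in> S\<close> \<open>c \<in> S\<close> \<open>d \<in> S\<close>
      by (simp flip: add add: closed inj_on_eq_iff[OF inj])
    then show ?thesis
      using that by (auto simp: grothendieck_rel_def img)
  qed
  have rel_class: "\<Phi> ` (?r `` {(a, b)}) = ?r' `` {(\<phi> a, \<phi> b)}" if "a \<in> S" "b \<in> S" for a b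
  proof
    show "\<Phi> ` (?r `` {(a, b)}) \<subseteq> ?r' `` {(\<phi> a, \<phi> b)}"
    proof
      fix x assume "x \<in> \<Phi> ` (?r `` {(a, b)})"
      then obtain c d where x: "x = \<Phi> (c, d)" and cd: "((a, b), (c, d)) \<in> ?r" by auto
      then have "c \<in> S" "d \<in> S" by (auto simp: grothendieck_rel_def)
      then show "x \<in> ?r' `` {(\<phi> a, \<phi> b)}" using rel cd that by (simp add: \<Phi>_def x)
    qed
    show "?r' `` {(\<phi> a, \<phi> b)} \<subseteq> \<Phi> ` (?r `` {(a, b)})"
    proof clarify
      fix c' d' assume *: "((\<phi> a, \<phi> b), (c', d')) \<in> ?r'"
      then have "c' \<in> S'" "d' \<in> S'" by (auto simp: grothendieck_rel_def)
      then obtain c d where "c \<in> S" "d \<in> S" "c' = \<phi> c" "d' = \<phi> d" by (auto simp: img)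
      then show "(c', d') \<in> \<Phi> ` (?r `` {(a, b)})"
        using rel[of a b c d] * that by (force simp: \<Phi>_def)
    qed
  qed
  have carrier': "(S' \<times> S') // ?r' = image \<Phi> ` ((S \<times> S) // ?r)"
  proof -
    have "(S' \<times> S') // ?r' = (\<lambda>(a, b). ?r' `` {(\<phi> a, \<phi> b)}) ` (S \<times> S)"
      unfolding quotient_def img by auto
    also have "\<dots> = (\<lambda>(a, b). \<Phi> ` (?r `` {(a, b)})) ` (S \<times> S)"
      by (rule image_cong) (clarsimp simp: rel_class)+
    also have "\<dots> = image \<Phi> ` ((S \<times> S) // ?r)"
      unfolding quotient_def by auto
    finally show ?thesis .
  qed
  have classes: "X \<subseteq> S \<times> S" if "X \<in> (S \<times> S) // ?r" for X
    using that by (auto simp: quotient_def grothendieck_rel_def)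
  have inj\<Phi>: "inj_on \<Phi> (S \<times> S)"
    unfolding \<Phi>_def using inj by (rule map_prod_inj_on) (rule inj)
  have mult: "\<Phi> ` (\<Union>(a, b)\<in>X. \<Union>(c, d)\<in>Y. ?r `` {(pl a c, pl b d)})
      = (\<Union>(a, b)\<in>\<Phi> ` X. \<Union>(c, d)\<in>\<Phi> ` Y. ?r' `` {(pl' a c, pl' b d)})"
    if "X \<subseteq> S \<times> S" "Y \<subseteq> S \<times> S" for X Y
  proof -
    have cls: "\<Phi> ` (?r `` {(pl (fst p) (fst q), pl (snd p) (snd q))})
        = ?r' `` {(pl' (\<phi> (fst p)) (\<phi> (fst q)), pl' (\<phi> (snd p)) (\<phi> (snd q)))}"
      if "p \<in> X" "q \<in> Y" for p q
    proof -
      have "fst p \<in> S" "snd p \<in> S" "fst q \<in> S" "snd q \<in> S"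
        using that \<open>X \<subseteq> S \<times> S\<close> \<open>Y \<subseteq> S \<times> S\<close> by auto
      then show ?thesis by (simp add: rel_class closed add)
    qed
    have "\<Phi> ` (\<Union>(a, b)\<in>X. \<Union>(c, d)\<in>Y. ?r `` {(pl a c, pl b d)})
        = (\<Union>p\<in>X. \<Union>q\<in>Y. \<Phi> ` (?r `` {(pl (fst p) (fst q), pl (snd p) (snd q))}))"
      by (simp only: image_UN split_beta)
    also have "\<dots> = (\<Union>p\<in>X. \<Union>q\<in>Y.
        ?r' `` {(pl' (\<phi> (fst p)) (\<phi> (fst q)), pl' (\<phi> (snd p)) (\<phi> (snd q)))})"
      by (intro SUP_cong refl cls)
    also have "\<dots> = (\<Union>(a, b)\<in>\<Phi> ` X. \<Union>(c, d)\<in>\<Phi> ` Y. ?r' `` {(pl' a c, pl' b d)})"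
      by (simp only: UN_simps split_beta \<Phi>_def fst_map_prod snd_map_prod)
    finally show ?thesis .
  qed
  have "bij_betw (image \<Phi>) ((S \<times> S) // ?r) ((S' \<times> S') // ?r')"
    unfolding bij_betw_def carrier'
    using inj_on_image_Pow[OF inj\<Phi>] classes by (auto intro: inj_on_subset)
  moreover have "image \<Phi> \<in> hom (grothendieck_group S pl) (grothendieck_group S' pl')"
  proof (rule homI)
    fix X Y assume "X \<in> carrier (grothendieck_group S pl)" "Y \<in> carrier (grothendieck_group S pl)"
    then show "\<Phi> ` (X \<otimes>\<^bsub>grothendieck_group S pl\<^esub> Y)
        = \<Phi> ` X \<otimes>\<^bsub>grothendieck_group S' pl'\<^esub> \<Phi> ` Y"
      using mult[OF classes classes] by (simp only: grothendieck_group_def monoid.simps partial_object.simps)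
  qed (simp add: grothendieck_group_def carrier')
  ultimately have "image \<Phi> \<in> iso (grothendieck_group S pl) (grothendieck_group S' pl')"
    by (simp add: iso_def grothendieck_group_def)
  then show ?thesis by (auto simp: is_iso_def)
qed

section \<open>Finitely supported sequences of vectors\<close>

text \<open>The union of all finite powers of \<open>W\<close>; each power consists of the sequences that are unchanged by
  truncation. Working in the union spares the bookkeeping of sizes.\<close>

definition fin_seqs :: "('x \<Rightarrow> complex) set \<Rightarrow> (nat \<times> 'x \<Rightarrow> complex) set" where
  "fin_seqs W = {F. (\<forall>i. curry F i \<in> W) \<and> (\<exists>m. \<forall>i\<ge>m. curry F i = 0)}"

definition trunc :: "nat \<Rightarrow> (nat \<times> 'x \<Rightarrow> complex) \<Rightarrow> nat \<times> 'x \<Rightarrow> complex" where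
  "trunc k F = (\<lambda>(i, x). if i < k then F (i, x) else 0)"

definition unshift :: "nat \<Rightarrow> (nat \<times> 'x \<Rightarrow> complex) \<Rightarrow> nat \<times> 'x \<Rightarrow> complex" where
  "unshift k F = (\<lambda>(i, x). F (i + k, x))"

lemma curry_eqI: "(\<And>i. curry F i = curry G i) \<Longrightarrow> F = G"
  by (auto simp: fun_eq_iff)

lemma curry_arith [simp]:
  "curry (F + G) i = curry F i + curry G i" "curry (F - G) i = curry F i - curry G i"
  "curry (fscale c F) i = fscale c (curry F i)" "curry 0 i = 0"
  by (auto simp: fscale_def fun_eq_iff)

lemma curry_seq [simp]:
  "curry (trunc k F) i = (if i < k then curry F i else 0)"
  "curry (unshift k F) i = curry F (i + k)"
  "curry (shift_summands k F) i = (if i < k then 0 else curry F (i - k))"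
  "curry (in_summand j v) i = (if i = j then v else 0)"
  by (auto simp: trunc_def unshift_def shift_summands_def in_summand_def fun_eq_iff)

lemma seq_arith [simp]:
  "trunc k (F + G) = trunc k F + trunc k G" "trunc k (F - G) = trunc k F - trunc k G"
  "unshift k (F + G) = unshift k F + unshift k G" "unshift k (F - G) = unshift k F - unshift k G"
  "shift_summands k (F + G) = shift_summands k F + shift_summands k G"
  "shift_summands k (F - G) = shift_summands k F - shift_summands k G"
  "trunc k 0 = 0" "unshift k 0 = 0" "shift_summands k 0 = 0"
  by (auto intro!: curry_eqI)

lemma seq_compose [simp]:
  "trunc k (trunc k F) = trunc k F" "trunc k (shift_summands k F) = 0"
  "unshift k (trunc k F) = 0" "unshift k (shift_summands k F) = F"
  by (auto intro!: curry_eqI)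

lemma trunc_plus_shift: "trunc k F + shift_summands k (trunc l (unshift k F)) = trunc (k + l) F"
  by (auto intro!: curry_eqI)

lemma seq_mem [simp]:
  assumes "cfun.subspace W"
  shows "F \<in> fin_seqs W \<Longrightarrow> G \<in> fin_seqs W \<Longrightarrow> F + G \<in> fin_seqs W"
    and "F \<in> fin_seqs W \<Longrightarrow> G \<in> fin_seqs W \<Longrightarrow> F - G \<in> fin_seqs W"
    and "F \<in> fin_seqs W \<Longrightarrow> trunc k F \<in> fin_seqs W"
    and "F \<in> fin_seqs W \<Longrightarrow> unshift k F \<in> fin_seqs W"
    and "F \<in> fin_seqs W \<Longrightarrow> shift_summands k F \<in> fin_seqs W"
    and "0 \<in> fin_seqs W"
    and "v \<in> W \<Longrightarrow> in_summand j v \<in> fin_seqs W"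
proof -
  note W = cfun.subspace_0[OF assms] cfun.subspace_add[OF assms] cfun.subspace_diff[OF assms]
  show "F + G \<in> fin_seqs W" "F - G \<in> fin_seqs W" if FG: "F \<in> fin_seqs W" "G \<in> fin_seqs W"
  proof -
    obtain m n where "\<forall>i\<ge>m. curry F i = 0" "\<forall>i\<ge>n. curry G i = 0"
      using FG by (auto simp: fin_seqs_def)
    then have "\<forall>i\<ge>max m n. curry (F + G) i = 0" "\<forall>i\<ge>max m n. curry (F - G) i = 0"
      by simp_all
    moreover have "curry (F + G) i \<in> W" "curry (F - G) i \<in> W" for i
      using FG W by (simp_all add: fin_seqs_def del: curry_conv)
    ultimately show "F + G \<in> fin_seqs W" "F - G \<in> fin_seqs W"
      unfolding fin_seqs_def by blast+
  qed
  show "trunc k F \<in> fin_seqs W" if "F \<in> fin_seqs W"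
    using that W by (auto simp: fin_seqs_def intro!: exI[of _ k])
  show "unshift k F \<in> fin_seqs W" if "F \<in> fin_seqs W"
    using that W by (auto simp: fin_seqs_def simp del: curry_conv) (meson le_add1 order_trans)
  show "shift_summands k F \<in> fin_seqs W" if "F \<in> fin_seqs W"
  proof -
    from that obtain m where "\<forall>i\<ge>m. curry F i = 0" by (auto simp: fin_seqs_def)
    then show ?thesis
      using that W by (auto simp: fin_seqs_def intro!: exI[of _ "m + k"])
  qed
  show "0 \<in> fin_seqs W" using W by (auto simp: fin_seqs_def)
  show "in_summand j v \<in> fin_seqs W" if "v \<in> W"
  proof -
    have "\<forall>i\<ge>Suc j. curry (in_summand j v) i = 0" by simp
    moreover have "curry (in_summand j v) i \<in> W" for i using that W by simp
    ultimately show ?thesis unfolding fin_seqs_def by blast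
  qed
qed

lemma trunc_eq_iff: "trunc m F = F \<longleftrightarrow> (\<forall>i\<ge>m. curry F i = 0)"
proof
  assume "trunc m F = F"
  then have "curry (trunc m F) i = curry F i" for i by simp
  then show "\<forall>i\<ge>m. curry F i = 0" by (metis curry_seq(1) not_le)
qed (auto intro!: curry_eqI)

lemma dsum_vec_iff:
  assumes "cfun.subspace (vec H)"
  shows "F \<in> vec (dsum_space m (\<lambda>_. H)) \<longleftrightarrow> F \<in> fin_seqs (vec H) \<and> trunc m F = F"
  using cfun.subspace_0[OF assms] unfolding trunc_eq_iff
  by (auto simp: dsum_space_def fin_seqs_def) (metis not_le)

lemma curve_power_iff:
  assumes "cfun.subspace (t w)"
  shows "F \<in> curve_power m t w \<longleftrightarrow> F \<in> fin_seqs (t w) \<and> trunc m F = F"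
  using cfun.subspace_0[OF assms] unfolding trunc_eq_iff
  by (auto simp: curve_power_def fin_seqs_def) (metis not_le)

section \<open>Norms in a Hilbert space and in its powers\<close>

context chilbert_space
begin

lemmas vec_0 = cfun.subspace_0[OF subspace_vec]
  and vec_add = cfun.subspace_add[OF subspace_vec]
  and vec_diff = cfun.subspace_diff[OF subspace_vec]
  and vec_scale = cfun.subspace_scale[OF subspace_vec]
  and vec_sum = cfun.subspace_sum[OF subspace_vec]

lemma ip_zero: "v \<in> vec H \<Longrightarrow> ip H 0 v = 0"
  using ip_scale[OF vec_0, of v 0] vec_0 by (simp add: fscale_def zero_fun_def)

lemma ip_nonneg: "v \<in> vec H \<Longrightarrow> Re (ip H v v) \<ge> 0"
  using ip_pos[of v] ip_zero[of v] by (cases "v = 0") auto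

lemma hnorm_nonneg: "v \<in> vec H \<Longrightarrow> hnorm H v \<ge> 0"
  by (simp add: hnorm_def ip_nonneg)

lemma hnorm_eq_0: "v \<in> vec H \<Longrightarrow> hnorm H v = 0 \<longleftrightarrow> v = 0"
  using ip_pos[of v] ip_zero[of v] by (cases "v = 0") (auto simp: hnorm_def)

lemma hnorm_square: "v \<in> vec H \<Longrightarrow> (hnorm H v)\<^sup>2 = Re (ip H v v)"
  by (simp add: hnorm_def ip_nonneg)

lemma hnorm_scale: "v \<in> vec H \<Longrightarrow> hnorm H (fscale c v) = cmod c * hnorm H v"
proof -
  assume v: "v \<in> vec H"
  have "ip H (fscale c v) (fscale c v) = c * cnj c * ip H v v"
    using v vec_scale[OF v, of c] ip_cnj[of "fscale c v" v] ip_cnj[of v v] by (simp add: ip_scale)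
  then show ?thesis
    by (simp add: hnorm_def complex_norm_square[symmetric] real_sqrt_mult
        flip: of_real_power)
qed

lemma ip_expand:
  assumes "u \<in> vec H" "v \<in> vec H"
  shows "Re (ip H (u + fscale (of_real s) v) (u + fscale (of_real s) v))
    = Re (ip H u u) + 2 * s * Re (ip H u v) + s\<^sup>2 * Re (ip H v v)"
proof -
  have r: "ip H x (u + fscale (of_real s) v) = ip H x u + of_real s * ip H x v" if "x \<in> vec H" for x
    using that assms ip_cnj[of "u + fscale (of_real s) v" x]
    by (simp add: ip_add vec_add vec_scale ip_scale ip_cnj[of x u] ip_cnj[of x v])
  show ?thesis
    using assms ip_cnj[of u v]
    by (simp add: ip_add vec_add vec_scale ip_scale r algebra_simps power2_eq_square)
qed

lemma hnorm_triangle: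
  assumes "u \<in> vec H" "v \<in> vec H"
  shows "hnorm H (u + v) \<le> hnorm H u + hnorm H v"
proof -
  \<comment> \<open>The quadratic polynomial \<open>s \<mapsto> \<parallel>u + s v\<parallel>\<^sup>2\<close> is nonnegative at its minimum.\<close>
  have CS: "Re (ip H u v) \<le> hnorm H u * hnorm H v"
  proof (cases "v = 0")
    case True
    then show ?thesis using assms ip_zero[of u] ip_cnj[of u v] by (simp add: hnorm_nonneg)
  next
    case False
    define s where "s = - Re (ip H u v) / Re (ip H v v)"
    have pos: "Re (ip H v v) > 0" using False assms ip_pos by blast
    have "0 \<le> Re (ip H u u) + 2 * s * Re (ip H u v) + s\<^sup>2 * Re (ip H v v)"
      unfolding ip_expand[OF assms, symmetric] using assms by (intro ip_nonneg vec_add vec_scale)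
    also have "\<dots> = Re (ip H u u) - (Re (ip H u v))\<^sup>2 / Re (ip H v v)"
      using pos by (simp add: s_def power2_eq_square field_simps)
    finally have "(Re (ip H u v))\<^sup>2 \<le> (hnorm H u * hnorm H v)\<^sup>2"
      using pos assms by (simp add: field_simps power_mult_distrib hnorm_square)
    then show ?thesis using assms hnorm_nonneg by (meson power2_le_imp_le mult_nonneg_nonneg)
  qed
  have "(hnorm H (u + v))\<^sup>2 \<le> (hnorm H u + hnorm H v)\<^sup>2"
    using CS ip_expand[OF assms, of 1] assms
    by (simp add: hnorm_square vec_add fscale_def power2_sum)
  then show ?thesis using assms hnorm_nonneg by (meson power2_le_imp_le add_nonneg_nonneg)
qed

lemma hnorm_diff:
  assumes "u \<in> vec H" "v \<in> vec H"
  shows "hnorm H (u - v) \<le> hnorm H u + hnorm H v"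
  using hnorm_triangle[OF assms(1) vec_scale[OF assms(2), of "-1"]] hnorm_scale[OF assms(2), of "-1"]
  by simp

lemma hnorm_sum:
  assumes "\<And>i. i \<in> I \<Longrightarrow> f i \<in> vec H"
  shows "hnorm H (\<Sum>i\<in>I. f i) \<le> (\<Sum>i\<in>I. hnorm H (f i))"
  using assms
proof (induction I rule: infinite_finite_induct)
  case (insert i I)
  then have "hnorm H (f i + sum f I) \<le> hnorm H (f i) + hnorm H (sum f I)"
    by (intro hnorm_triangle vec_sum) auto
  then show ?case
    unfolding sum.insert[OF insert.hyps] using insert by (meson add_left_mono insertCI order_trans)
qed (use hnorm_eq_0[OF vec_0] in auto)

lemma hnorm_dsum:
  assumes "\<And>i. curry F i \<in> vec H"
  shows "hnorm (dsum_space m (\<lambda>_. H)) F = L2_set (\<lambda>i. hnorm H (curry F i)) {..<m}"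
  unfolding L2_set_def hnorm_square[OF assms]
  by (simp add: hnorm_def dsum_space_def)

end

section \<open>The algebra of a curve with dense span\<close>

locale spanning_curve = chilbert_space H for H :: "'x hspace" +
  fixes t :: "complex \<Rightarrow> ('x \<Rightarrow> complex) set"
  assumes fibre_subspace: "w \<in> unit_disc \<Longrightarrow> cfun.subspace (t w)"
    and fibre_subset: "w \<in> unit_disc \<Longrightarrow> t w \<subseteq> vec H"
    and fibres_dense: "dense_in H (cfun.span (\<Union>w\<in>unit_disc. t w))"
begin

abbreviation "R \<equiv> curve_algebra H t"
abbreviation "vecs \<equiv> fin_seqs (vec H)"
abbreviation "Hpow m \<equiv> vec (dsum_space m (\<lambda>_. H))"

lemmas [simp] = vec_0 vec_add vec_diff vec_scale vec_sum
  and vecs_mem [simp] = seq_mem[OF subspace_vec]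
  and fibre_seq_mem = seq_mem[OF fibre_subspace]

lemma vecs_curry [simp]: "F \<in> vecs \<Longrightarrow> curry F i \<in> vec H"
  by (simp add: fin_seqs_def)

lemma vecs_scale: "F \<in> vecs \<Longrightarrow> fscale c F \<in> vecs"
  unfolding fin_seqs_def by auto

lemma fibre_seqs_subset: "w \<in> unit_disc \<Longrightarrow> fin_seqs (t w) \<subseteq> vecs"
  using fibre_subset[of w] unfolding fin_seqs_def by blast

lemmas Hpow_iff = dsum_vec_iff[OF subspace_vec]

lemma fibre_power_iff:
  "w \<in> unit_disc \<Longrightarrow> F \<in> curve_power m t w \<longleftrightarrow> F \<in> fin_seqs (t w) \<and> trunc m F = F"
  by (rule curve_power_iff) (rule fibre_subspace)

lemma R_simps:
  "A \<otimes>\<^bsub>R\<^esub> B = compose (vec H) A B" "\<one>\<^bsub>R\<^esub> = (\<lambda>v\<in>vec H. v)" "\<zero>\<^bsub>R\<^esub> = (\<lambda>v\<in>vec H. 0)"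
  "A \<oplus>\<^bsub>R\<^esub> B = (\<lambda>v\<in>vec H. A v + B v)"
  by (simp_all add: curve_algebra_def)

lemma R_zero_apply [simp]: "v \<in> vec H \<Longrightarrow> \<zero>\<^bsub>R\<^esub> v = 0"
  by (simp add: R_simps)

lemma R_closed [simp]: "A \<in> carrier R \<Longrightarrow> v \<in> vec H \<Longrightarrow> A v \<in> vec H"
  and R_fibre: "A \<in> carrier R \<Longrightarrow> w \<in> unit_disc \<Longrightarrow> v \<in> t w \<Longrightarrow> A v \<in> t w"
  and R_add: "A \<in> carrier R \<Longrightarrow> u \<in> vec H \<Longrightarrow> v \<in> vec H \<Longrightarrow> A (u + v) = A u + A v"
  and R_scale: "A \<in> carrier R \<Longrightarrow> v \<in> vec H \<Longrightarrow> A (fscale c v) = fscale c (A v)"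
  and R_extensional: "A \<in> carrier R \<Longrightarrow> A \<in> extensional (vec H)"
  and R_bounded_ex: "A \<in> carrier R \<Longrightarrow> \<exists>C. \<forall>v\<in>vec H. hnorm H (A v) \<le> C * hnorm H v"
  by (auto simp: curve_algebra_def bounded_ops_def PiE_iff image_subset_iff)

lemma R_0 [simp]: "A \<in> carrier R \<Longrightarrow> A 0 = 0"
  using R_add[of A 0 0] by simp

lemma R_diff: "A \<in> carrier R \<Longrightarrow> u \<in> vec H \<Longrightarrow> v \<in> vec H \<Longrightarrow> A (u - v) = A u - A v"
  using R_add[of A "u - v" v] by (simp add: eq_diff_eq)

lemma R_sum:
  assumes "A \<in> carrier R" "\<And>i. i \<in> I \<Longrightarrow> f i \<in> vec H"
  shows "A (\<Sum>i\<in>I. f i) = (\<Sum>i\<in>I. A (f i))"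
  using assms(2)
proof (induction I rule: infinite_finite_induct)
  case (insert i I)
  then have "A (f i + sum f I) = A (f i) + A (sum f I)"
    by (intro R_add assms(1) vec_sum) auto
  then show ?case
    unfolding sum.insert[OF insert.hyps] using insert by (metis insertCI)
qed (use assms in auto)

lemma R_bounded:
  assumes "A \<in> carrier R"
  shows "\<exists>C\<ge>0. \<forall>v\<in>vec H. hnorm H (A v) \<le> C * hnorm H v"
proof -
  obtain C where C: "hnorm H (A v) \<le> C * hnorm H v" if "v \<in> vec H" for v
    using R_bounded_ex[OF assms] by blast
  have "hnorm H (A v) \<le> \<bar>C\<bar> * hnorm H v" if "v \<in> vec H" for v
    using C[OF that] hnorm_nonneg[OF that] by (meson abs_ge_self mult_right_mono order_trans)
  then show ?thesis by (intro exI[of _ "\<bar>C\<bar>"]) simp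
qed

lemma R_carrierI:
  assumes "\<And>v. v \<in> vec H \<Longrightarrow> f v \<in> vec H"
    and "\<And>u v. u \<in> vec H \<Longrightarrow> v \<in> vec H \<Longrightarrow> f (u + v) = f u + f v"
    and "\<And>c v. v \<in> vec H \<Longrightarrow> f (fscale c v) = fscale c (f v)"
    and "\<And>v. v \<in> vec H \<Longrightarrow> hnorm H (f v) \<le> C * hnorm H v"
    and "\<And>w v. w \<in> unit_disc \<Longrightarrow> v \<in> t w \<Longrightarrow> f v \<in> t w"
  shows "(\<lambda>v\<in>vec H. f v) \<in> carrier R"
proof -
  have "(\<lambda>v\<in>vec H. f v) \<in> bounded_ops H"
    unfolding bounded_ops_def using assms(1-4) by (auto intro!: exI[of _ C])
  moreover have "(\<lambda>v\<in>vec H. f v) ` t w \<subseteq> t w" if "w \<in> unit_disc" for w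
    using assms(5)[OF that] fibre_subset[OF that] by auto
  ultimately show ?thesis by (simp add: curve_algebra_def)
qed

lemma R_add_closed:
  assumes "A \<in> carrier R" "B \<in> carrier R"
  shows "A \<oplus>\<^bsub>R\<^esub> B \<in> carrier R"
proof -
  obtain C where C: "C \<ge> 0" "\<And>v. v \<in> vec H \<Longrightarrow> hnorm H (A v) \<le> C * hnorm H v"
    using R_bounded[OF assms(1)] by blast
  obtain D where D: "D \<ge> 0" "\<And>v. v \<in> vec H \<Longrightarrow> hnorm H (B v) \<le> D * hnorm H v"
    using R_bounded[OF assms(2)] by blast
  have "hnorm H (A v + B v) \<le> (C + D) * hnorm H v" if "v \<in> vec H" for v
    using hnorm_triangle[of "A v" "B v"] C(2)[of v] D(2)[of v] that assms by (simp add: distrib_right)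
  moreover have "A v + B v \<in> t w" if "w \<in> unit_disc" "v \<in> t w" for w v
    using that assms by (simp add: cfun.subspace_add[OF fibre_subspace] R_fibre)
  ultimately show ?thesis
    unfolding R_simps using assms
    by (intro R_carrierI[where C = "C + D"]) (simp_all add: R_add[OF assms(1)] R_add[OF assms(2)] R_scale cfun.scale_right_distrib add_ac)
qed

lemma R_diff_closed:
  assumes "A \<in> carrier R" "B \<in> carrier R"
  shows "(\<lambda>v\<in>vec H. A v - B v) \<in> carrier R"
proof -
  obtain C where C: "C \<ge> 0" "\<And>v. v \<in> vec H \<Longrightarrow> hnorm H (A v) \<le> C * hnorm H v"
    using R_bounded[OF assms(1)] by blast
  obtain D where D: "D \<ge> 0" "\<And>v. v \<in> vec H \<Longrightarrow> hnorm H (B v) \<le> D * hnorm H v"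
    using R_bounded[OF assms(2)] by blast
  have "hnorm H (A v - B v) \<le> (C + D) * hnorm H v" if "v \<in> vec H" for v
    using hnorm_diff[of "A v" "B v"] C(2)[of v] D(2)[of v] that assms by (simp add: distrib_right)
  moreover have "A v - B v \<in> t w" if "w \<in> unit_disc" "v \<in> t w" for w v
    using that assms by (simp add: cfun.subspace_diff[OF fibre_subspace] R_fibre)
  ultimately show ?thesis
    unfolding R_simps using assms
    by (intro R_carrierI[where C = "C + D"]) (simp_all add: R_add[OF assms(1)] R_add[OF assms(2)] R_scale cfun.scale_right_diff_distrib algebra_simps)
qed

lemma R_mult_closed:
  assumes "A \<in> carrier R" "B \<in> carrier R"
  shows "A \<otimes>\<^bsub>R\<^esub> B \<in> carrier R"
proof -
  obtain C where C: "C \<ge> 0" "\<And>v. v \<in> vec H \<Longrightarrow> hnorm H (A v) \<le> C * hnorm H v"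
    using R_bounded[OF assms(1)] by blast
  obtain D where D: "D \<ge> 0" "\<And>v. v \<in> vec H \<Longrightarrow> hnorm H (B v) \<le> D * hnorm H v"
    using R_bounded[OF assms(2)] by blast
  have "hnorm H (A (B v)) \<le> (C * D) * hnorm H v" if "v \<in> vec H" for v
    using C(2)[of "B v"] mult_left_mono[OF D(2)[OF that] C(1)] assms that by (simp add: mult.assoc)
  then show ?thesis
    unfolding R_simps compose_def using assms
    by (intro R_carrierI[where C = "C * D"]) (simp_all add: R_add[OF assms(1)] R_add[OF assms(2)] R_scale R_fibre)
qed

lemma R_zero_closed [simp]: "\<zero>\<^bsub>R\<^esub> \<in> carrier R"
  unfolding R_simps
  by (rule R_carrierI[where C = 0])
    (simp_all add: cfun.subspace_0[OF fibre_subspace] hnorm_eq_0[OF vec_0, THEN iffD2])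

lemma R_one_closed [simp]: "\<one>\<^bsub>R\<^esub> \<in> carrier R"
  unfolding R_simps by (rule R_carrierI[where C = 1]) auto

lemma R_eqI:
  assumes "A \<in> carrier R" "B \<in> carrier R" "\<And>v. v \<in> vec H \<Longrightarrow> A v = B v"
  shows "A = B"
  using assms R_extensional by (meson extensionalityI)

lemma R_abelian_monoid: "abelian_monoid R"
proof (rule abelian_monoidI)
  show "x \<oplus>\<^bsub>R\<^esub> y \<oplus>\<^bsub>R\<^esub> z = x \<oplus>\<^bsub>R\<^esub> (y \<oplus>\<^bsub>R\<^esub> z)" for x y z
    by (simp add: R_simps fun_eq_iff add.assoc)
  show "\<zero>\<^bsub>R\<^esub> \<oplus>\<^bsub>R\<^esub> x = x" if "x \<in> carrier R" for x
    by (rule R_eqI) (auto simp: R_add_closed that, simp add: R_simps)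
  show "x \<oplus>\<^bsub>R\<^esub> y = y \<oplus>\<^bsub>R\<^esub> x" for x y
    by (simp add: R_simps fun_eq_iff add.commute)
qed (auto intro: R_add_closed)

lemma R_finsum_apply:
  assumes "finite I" "\<And>i. i \<in> I \<Longrightarrow> f i \<in> carrier R" "v \<in> vec H"
  shows "(\<Oplus>\<^bsub>R\<^esub>i\<in>I. f i) v = (\<Sum>i\<in>I. f i v)"
  using assms
proof (induction I)
  case empty
  then show ?case by (simp add: abelian_monoid.finsum_empty[OF R_abelian_monoid])
next
  case (insert i I)
  then have "(\<Oplus>\<^bsub>R\<^esub>i\<in>insert i I. f i) = f i \<oplus>\<^bsub>R\<^esub> (\<Oplus>\<^bsub>R\<^esub>i\<in>I. f i)"
    by (intro abelian_monoid.finsum_insert[OF R_abelian_monoid]) auto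
  moreover have "(\<Sum>i\<in>insert i I. f i v) = f i v + (\<Sum>i\<in>I. f i v)"
    using insert.hyps by (rule sum.insert)
  ultimately show ?case
    using insert by (simp add: R_simps)
qed

text \<open>The place where density is used: two bounded operators that agree on the fibres agree on their
  span, and then everywhere by continuity.\<close>

lemma R_eqI_fibres:
  assumes A: "A \<in> carrier R" and B: "B \<in> carrier R"
    and eq: "\<And>w v. w \<in> unit_disc \<Longrightarrow> v \<in> t w \<Longrightarrow> A v = B v"
  shows "A = B"
proof (rule R_eqI[OF A B])
  fix v assume v: "v \<in> vec H"
  let ?S = "cfun.span (\<Union>w\<in>unit_disc. t w)"
  have "?S \<subseteq> {v \<in> vec H. A v = B v}"
  proof (rule cfun.span_minimal)
    show "(\<Union>w\<in>unit_disc. t w) \<subseteq> {v \<in> vec H. A v = B v}"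
      using fibre_subset eq by blast
    show "cfun.subspace {v \<in> vec H. A v = B v}"
      using A B by (simp add: cfun.subspace_def R_add[OF A] R_add[OF B] R_scale)
  qed
  then have S: "u \<in> vec H" "A u = B u" if "u \<in> ?S" for u
    using that by auto
  obtain C where C: "C \<ge> 0" "\<And>v. v \<in> vec H \<Longrightarrow> hnorm H (A v) \<le> C * hnorm H v"
    using R_bounded[OF A] by blast
  obtain D where D: "D \<ge> 0" "\<And>v. v \<in> vec H \<Longrightarrow> hnorm H (B v) \<le> D * hnorm H v"
    using R_bounded[OF B] by blast
  have le: "hnorm H (A v - B v) \<le> (C + D) * hnorm H (v - u)" if "u \<in> ?S" for u
  proof -
    have "A v - B v = A (v - u) - B (v - u)"
      using S[OF that] v A B by (simp add: R_diff[OF A] R_diff[OF B])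
    then have "hnorm H (A v - B v) \<le> hnorm H (A (v - u)) + hnorm H (B (v - u))"
      using hnorm_diff[of "A (v - u)" "B (v - u)"] S(1)[OF that] v A B by simp
    also have "\<dots> \<le> (C + D) * hnorm H (v - u)"
      using C(2)[of "v - u"] D(2)[of "v - u"] S(1)[OF that] v by (simp add: algebra_simps)
    finally show ?thesis .
  qed
  have "hnorm H (A v - B v) \<le> e" if "e > 0" for e
  proof -
    have "e / (C + D + 1) > 0" using that C(1) D(1) by simp
    then obtain u where u: "u \<in> ?S" "hnorm H (v - u) < e / (C + D + 1)"
      using fibres_dense v unfolding dense_in_def by blast
    then have "(C + D) * hnorm H (v - u) \<le> (C + D + 1) * (e / (C + D + 1))"
      using C(1) D(1) S(1)[OF u(1)] v by (intro mult_mono) (auto intro: hnorm_nonneg)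
    then show ?thesis using le[OF u(1)] C(1) D(1) by simp
  qed
  then have "hnorm H (A v - B v) = 0"
    using hnorm_nonneg[of "A v - B v"] A B v field_le_epsilon[of "hnorm H (A v - B v)" 0] by force
  then show "A v = B v" using A B v by (simp add: hnorm_eq_0)
qed

section \<open>Matrices as operators\<close>

text \<open>The action of a matrix on column vectors. The index set of the sum is the one of
  \<^const>\<open>mat_mult\<close>, and matrices of all sizes act on the same space of finitely supported
  sequences, just as they are padded with zeros to infinite ones.\<close>

definition mat_op ::
  "(nat \<Rightarrow> nat \<Rightarrow> ('x \<Rightarrow> complex) \<Rightarrow> ('x \<Rightarrow> complex)) \<Rightarrow> (nat \<times> 'x \<Rightarrow> complex) \<Rightarrow> nat \<times> 'x \<Rightarrow> complex"
  where "mat_op a F = case_prod (\<lambda>i. \<Sum>l\<in>{l. a i l \<noteq> \<zero>\<^bsub>R\<^esub>}. a i l (curry F l))"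

lemma matrices_mono: "a \<in> matrices R k \<Longrightarrow> k \<le> m \<Longrightarrow> a \<in> matrices R m"
  by (auto simp: matrices_def)

lemma matrices_carrier: "a \<in> matrices R k \<Longrightarrow> a i j \<in> carrier R"
  by (auto simp: matrices_def)

lemma matrices_zero: "a \<in> matrices R k \<Longrightarrow> k \<le> i \<or> k \<le> j \<Longrightarrow> a i j = \<zero>\<^bsub>R\<^esub>"
  unfolding matrices_def by blast

lemma matrices_inf_carrier: "a \<in> matrices_inf R \<Longrightarrow> a i j \<in> carrier R"
  unfolding matrices_inf_def matrices_def by blast

lemma matrices_infI: "a \<in> matrices R k \<Longrightarrow> a \<in> matrices_inf R"
  by (auto simp: matrices_inf_def)

lemma common_size:
  assumes "a \<in> matrices_inf R" "b \<in> matrices_inf R"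
  obtains m where "a \<in> matrices R m" "b \<in> matrices R m" "n \<le> m"
proof -
  obtain k l where "a \<in> matrices R k" "b \<in> matrices R l"
    using assms by (auto simp: matrices_inf_def)
  then show thesis
    using that[of "k + l + n"] matrices_mono by (metis le_add1 le_add2 le_add_same_cancel1 trans_le_add1)
qed

lemma matrices_row_subset: "a \<in> matrices R k \<Longrightarrow> {l. a i l \<noteq> \<zero>\<^bsub>R\<^esub>} \<subseteq> {..<k}"
  using matrices_zero[of a k i] by (auto simp: not_le[symmetric])

lemma mat_op_row:
  assumes "a \<in> matrices R m" "F \<in> vecs"
  shows "curry (mat_op a F) i = (\<Sum>l<m. a i l (curry F l))"
proof -
  have "curry (mat_op a F) i = (\<Sum>l\<in>{l. a i l \<noteq> \<zero>\<^bsub>R\<^esub>}. a i l (curry F l))"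
    by (simp add: mat_op_def)
  also have "\<dots> = (\<Sum>l<m. a i l (curry F l))"
    using matrices_row_subset[OF assms(1)] vecs_curry[OF assms(2)]
    by (intro sum.mono_neutral_left) (auto)
  finally show ?thesis .
qed

lemma mat_op_mem:
  assumes "a \<in> matrices R k" "cfun.subspace W" "F \<in> fin_seqs W" "W \<subseteq> vec H"
    and "\<And>i j v. v \<in> W \<Longrightarrow> a i j v \<in> W"
  shows "mat_op a F \<in> fin_seqs W"
proof -
  have F: "F \<in> vecs" "\<And>i. curry F i \<in> W"
    using assms(3,4) unfolding fin_seqs_def by blast+
  have "curry (mat_op a F) i = 0" if "i \<ge> k" for i
    unfolding mat_op_row[OF assms(1) F(1)] using F
    by (intro sum.neutral ballI) (simp add: matrices_zero[OF assms(1) disjI1[OF that]])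
  moreover have "curry (mat_op a F) i \<in> W" for i
    unfolding mat_op_row[OF assms(1) F(1)]
    by (rule cfun.subspace_sum[OF assms(2)]) (rule assms(5)[OF F(2)])
  ultimately show ?thesis unfolding fin_seqs_def by blast
qed

lemma mat_op_closed [simp]: "a \<in> matrices_inf R \<Longrightarrow> F \<in> vecs \<Longrightarrow> mat_op a F \<in> vecs"
  unfolding matrices_inf_def
  by (elim UN_E) (rule mat_op_mem[OF _ subspace_vec], simp_all add: R_closed[OF matrices_carrier])

lemma mat_op_fibre:
  "a \<in> matrices_inf R \<Longrightarrow> w \<in> unit_disc \<Longrightarrow> F \<in> fin_seqs (t w) \<Longrightarrow> mat_op a F \<in> fin_seqs (t w)"
  unfolding matrices_inf_def
  by (elim UN_E) (rule mat_op_mem[OF _ fibre_subspace _ fibre_subset], simp_all add: R_fibre[OF matrices_carrier])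

lemma mat_op_add [simp]:
  assumes "a \<in> matrices_inf R" "F \<in> vecs" "G \<in> vecs"
  shows "mat_op a (F + G) = mat_op a F + mat_op a G"
proof -
  obtain k where k: "a \<in> matrices R k" using assms(1) common_size by blast
  show ?thesis
    using assms
    by (intro curry_eqI)
      (simp add: mat_op_row[OF k] R_add[OF matrices_carrier[OF k]] sum.distrib)
qed

lemma mat_op_diff [simp]:
  assumes "a \<in> matrices_inf R" "F \<in> vecs" "G \<in> vecs"
  shows "mat_op a (F - G) = mat_op a F - mat_op a G"
  using mat_op_add[of a "F - G" G] assms by (simp add: eq_diff_eq)

lemma mat_op_0 [simp]: "a \<in> matrices_inf R \<Longrightarrow> mat_op a 0 = 0"
  using mat_op_diff[of a 0 0] by simp

lemma mat_op_scale:
  assumes "a \<in> matrices R k" "F \<in> vecs"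
  shows "mat_op a (fscale c F) = fscale c (mat_op a F)"
proof -
  show ?thesis
    using assms(2) vecs_scale[OF assms(2)]
    by (intro curry_eqI)
      (simp add: mat_op_row[OF assms(1)] R_scale[OF matrices_carrier[OF assms(1)]]
        cfun.scale_sum_right)
qed

lemma trunc_mat_op: "a \<in> matrices R k \<Longrightarrow> F \<in> vecs \<Longrightarrow> trunc k (mat_op a F) = mat_op a F"
  unfolding trunc_eq_iff by (simp add: mat_op_row[of a k] matrices_zero[of a k])

lemma mat_op_trunc: "a \<in> matrices R k \<Longrightarrow> F \<in> vecs \<Longrightarrow> mat_op a (trunc k F) = mat_op a F"
  by (intro curry_eqI) (simp add: mat_op_row[of a k])

lemma mat_op_in_summand:
  assumes "a \<in> matrices_inf R" "v \<in> vec H"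
  shows "curry (mat_op a (in_summand j v)) i = a i j v"
proof -
  obtain k where k: "a \<in> matrices R k" "j < k"
    using common_size[OF assms(1,1), of "Suc j"] by (metis Suc_le_lessD)
  have "curry (mat_op a (in_summand j v)) i = (\<Sum>l<k. a i l (if l = j then v else 0))"
    using assms(2) by (simp add: mat_op_row[OF k(1)])
  also have "\<dots> = (\<Sum>l<k. if l = j then a i j v else 0)"
    using R_0[OF matrices_carrier[OF k(1)]] by (intro sum.cong refl) simp
  finally show ?thesis using k(2) by simp
qed

text \<open>Matrices act faithfully already on the fibres. Identities between products of matrices can hence be
  checked on vectors.\<close>

lemma mat_op_eqI:
  assumes "a \<in> matrices_inf R" "b \<in> matrices_inf R"
    and "\<And>w F. w \<in> unit_disc \<Longrightarrow> F \<in> fin_seqs (t w) \<Longrightarrow> mat_op a F = mat_op b F"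
  shows "a = b"
proof -
  have "a i j v = b i j v" if w: "w \<in> unit_disc" "v \<in> t w" for i j w v
  proof -
    have "in_summand j v \<in> fin_seqs (t w)" "v \<in> vec H"
      using w fibre_seq_mem(7) fibre_subset by blast+
    then show ?thesis
      using assms w by (metis mat_op_in_summand)
  qed
  then have "a i j = b i j" for i j
    using assms by (intro R_eqI_fibres matrices_inf_carrier)
  then show ?thesis by (simp add: fun_eq_iff)
qed

lemma mat_op_eqI_vecs:
  assumes "a \<in> matrices_inf R" "b \<in> matrices_inf R" "\<And>F. F \<in> vecs \<Longrightarrow> mat_op a F = mat_op b F"
  shows "a = b"
  by (rule mat_op_eqI[OF assms(1,2)]) (use assms(3) fibre_seqs_subset in blast)

lemma mat_mult_closed:
  assumes a: "a \<in> matrices R k" and b: "b \<in> matrices R k"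
  shows "mat_mult R a b \<in> matrices R k"
proof -
  note [simp] = matrices_carrier[OF a] matrices_carrier[OF b]
  have mem: "mat_mult R a b i j \<in> carrier R" for i j
    unfolding mat_mult_def using a b
    by (intro abelian_monoid.finsum_closed[OF R_abelian_monoid]) (auto intro: R_mult_closed)
  have fin: "finite {l. a i l \<noteq> \<zero>\<^bsub>R\<^esub>}" for i
    using matrices_row_subset[OF a] finite_subset by blast
  have "mat_mult R a b i j = \<zero>\<^bsub>R\<^esub>" if "i \<ge> k \<or> j \<ge> k" for i j
  proof (rule R_eqI[OF mem R_zero_closed])
    fix v assume v: "v \<in> vec H"
    have "(a i l \<otimes>\<^bsub>R\<^esub> b l j) v = 0" for l
      using that v a b matrices_zero[OF a, of i l] matrices_zero[OF b, of l j]
      by (auto simp: R_simps(1) compose_eq)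
    then show "mat_mult R a b i j v = \<zero>\<^bsub>R\<^esub> v"
      unfolding mat_mult_def using a b v fin by (subst R_finsum_apply) (auto intro: R_mult_closed)
  qed
  with mem show ?thesis unfolding matrices_def by blast
qed

lemma mat_mult_closed_inf [simp]:
  assumes "a \<in> matrices_inf R" "b \<in> matrices_inf R"
  shows "mat_mult R a b \<in> matrices_inf R"
proof -
  obtain m where "a \<in> matrices R m" "b \<in> matrices R m"
    using assms common_size by blast
  then show ?thesis by (rule matrices_infI[OF mat_mult_closed])
qed

lemma mat_op_mult [simp]:
  assumes "a \<in> matrices_inf R" "b \<in> matrices_inf R" "F \<in> vecs"
  shows "mat_op (mat_mult R a b) F = mat_op a (mat_op b F)"
proof (rule curry_eqI)
  fix i
  obtain m where a: "a \<in> matrices R m" and b: "b \<in> matrices R m"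
    using assms common_size by blast
  note [simp] = matrices_carrier[OF a] matrices_carrier[OF b]
  let ?I = "{l. a i l \<noteq> \<zero>\<^bsub>R\<^esub>}"
  have fin: "finite ?I" using matrices_row_subset[OF a] finite_subset by blast
  have "curry (mat_op (mat_mult R a b) F) i = (\<Sum>j<m. mat_mult R a b i j (curry F j))"
    by (rule mat_op_row[OF mat_mult_closed[OF a b] assms(3)])
  also have "\<dots> = (\<Sum>j<m. \<Sum>l\<in>?I. a i l (b l j (curry F j)))"
    unfolding mat_mult_def using a b fin assms(3)
    by (intro sum.cong refl, subst R_finsum_apply)
      (auto simp: R_simps(1) compose_eq intro: R_mult_closed[unfolded R_simps(1)])
  also have "\<dots> = (\<Sum>l\<in>?I. \<Sum>j<m. a i l (b l j (curry F j)))"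
    by (rule sum.swap)
  also have "\<dots> = (\<Sum>l\<in>?I. a i l (curry (mat_op b F) l))"
    using a b assms(3)
    by (intro sum.cong refl) (simp add: mat_op_row[OF b] R_sum)
  also have "\<dots> = curry (mat_op a (mat_op b F)) i"
    by (simp add: mat_op_def)
  finally show "curry (mat_op (mat_mult R a b) F) i = curry (mat_op a (mat_op b F)) i" .
qed

section \<open>Algebraic equivalence of idempotents\<close>

text \<open>A block matrix whose upper left block has \<open>r\<close> rows and \<open>s\<close> columns.\<close>

definition block ::
  "nat \<Rightarrow> nat \<Rightarrow> (nat \<Rightarrow> nat \<Rightarrow> 'b) \<Rightarrow> (nat \<Rightarrow> nat \<Rightarrow> 'b) \<Rightarrow> (nat \<Rightarrow> nat \<Rightarrow> 'b) \<Rightarrow> (nat \<Rightarrow> nat \<Rightarrow> 'b)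
    \<Rightarrow> nat \<Rightarrow> nat \<Rightarrow> 'b" where
  "block r s a b c d = (\<lambda>i j.
     if i < r then if j < s then a i j else b i (j - s)
     else if j < s then c (i - r) j else d (i - r) (j - s))"

definition zero_mat :: "nat \<Rightarrow> nat \<Rightarrow> ('x \<Rightarrow> complex) \<Rightarrow> ('x \<Rightarrow> complex)" where
  "zero_mat = (\<lambda>i j. \<zero>\<^bsub>R\<^esub>)"

lemma zero_mat_closed [simp]: "zero_mat \<in> matrices R k" "zero_mat \<in> matrices_inf R"
  by (auto simp: zero_mat_def matrices_def matrices_inf_def)

lemma mat_op_zero [simp]: "mat_op zero_mat F = 0"
  by (auto simp: mat_op_def zero_mat_def fun_eq_iff)

lemma block_matrices:
  assumes "a \<in> matrices R m" "b \<in> matrices R m" "c \<in> matrices R m" "d \<in> matrices R m"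
  shows "block r s a b c d \<in> matrices R (r + s + m)"
proof -
  have "block r s a b c d i j \<in> carrier R" for i j
    using assms by (simp add: block_def matrices_carrier)
  moreover have "block r s a b c d i j = \<zero>\<^bsub>R\<^esub>" if "i \<ge> r + s + m \<or> j \<ge> r + s + m" for i j
    unfolding block_def using that
    by (auto intro!: matrices_zero[OF assms(1)] matrices_zero[OF assms(2)]
        matrices_zero[OF assms(3)] matrices_zero[OF assms(4)])
  ultimately show ?thesis unfolding matrices_def by blast
qed

lemma sum_split: "(\<Sum>l<s + m. f l) = (\<Sum>l<s. f l) + (\<Sum>l<m. f (l + s))" for f :: "nat \<Rightarrow> 'b::comm_monoid_add"
  by (induction m) (simp_all add: ac_simps)

text \<open>The truncated and the shifted part of a sequence are its components with respect to the block
  decomposition, so this is the usual rule for applying a block matrix to a vector.\<close>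

lemma block_op:
  assumes "a \<in> matrices_inf R" "b \<in> matrices_inf R" "c \<in> matrices_inf R" "d \<in> matrices_inf R"
  shows "block r s a b c d \<in> matrices_inf R"
    and "F \<in> vecs \<Longrightarrow> mat_op (block r s a b c d) F =
      trunc r (mat_op a (trunc s F) + mat_op b (unshift s F))
      + shift_summands r (mat_op c (trunc s F) + mat_op d (unshift s F))"
proof -
  obtain k l where "a \<in> matrices R k" "b \<in> matrices R k" "c \<in> matrices R l" "d \<in> matrices R l"
    using common_size[OF assms(1,2)] common_size[OF assms(3,4)] by metis
  then obtain m where a: "a \<in> matrices R m" and b: "b \<in> matrices R m" and c: "c \<in> matrices R m"
    and d: "d \<in> matrices R m"
    using matrices_mono by (metis le_add1 le_add2)
  note block = block_matrices[OF a b c d, of r s]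
  then show "block r s a b c d \<in> matrices_inf R" by (rule matrices_infI)
  assume F: "F \<in> vecs"
  have top: "curry (mat_op e (trunc s F)) i = (\<Sum>l<s. e i l (curry F l))" if e: "e \<in> matrices R m" for e i
  proof -
    have "e \<in> matrices R (s + m)" using e by (rule matrices_mono) simp
    then have "curry (mat_op e (trunc s F)) i = (\<Sum>l<s + m. e i l (if l < s then curry F l else 0))"
      using F by (simp add: mat_op_row)
    then show ?thesis
      unfolding sum_split using R_0[OF matrices_carrier[OF e]] by simp
  qed
  have bottom: "curry (mat_op e (unshift s F)) i = (\<Sum>l<r + m. e i l (curry F (l + s)))"
    if e: "e \<in> matrices R m" for e i
    using mat_op_row[OF matrices_mono[OF e, of "r + m"], of "unshift s F" i] F by simp
  have "curry (mat_op (block r s a b c d) F) i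
      = (\<Sum>l<s. block r s a b c d i l (curry F l))
        + (\<Sum>l<r + m. block r s a b c d i (l + s) (curry F (l + s)))" for i
    using mat_op_row[OF block F, of i] sum_split[of _ s "r + m"] by (simp add: ac_simps)
  then show "mat_op (block r s a b c d) F =
      trunc r (mat_op a (trunc s F) + mat_op b (unshift s F))
      + shift_summands r (mat_op c (trunc s F) + mat_op d (unshift s F))"
    by (intro curry_eqI) (simp add: top bottom a b c d block_def)
qed

lemma diag_sum_block: "diag_sum R k p q = block k k p zero_mat zero_mat q"
  by (auto simp: diag_sum_def block_def zero_mat_def fun_eq_iff not_less)

text \<open>The matrix \<open>1 - q\<close>, where \<open>1\<close> is the unit matrix of size \<open>k\<close>.\<close>

definition complement :: "nat \<Rightarrow> (nat \<Rightarrow> nat \<Rightarrow> ('x \<Rightarrow> complex) \<Rightarrow> ('x \<Rightarrow> complex))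
    \<Rightarrow> nat \<Rightarrow> nat \<Rightarrow> ('x \<Rightarrow> complex) \<Rightarrow> ('x \<Rightarrow> complex)" where
  "complement k q = (\<lambda>i j. if i < k \<and> j < k
     then (\<lambda>v\<in>vec H. (if i = j then \<one>\<^bsub>R\<^esub> else \<zero>\<^bsub>R\<^esub>) v - q i j v) else \<zero>\<^bsub>R\<^esub>)"

lemma complement_matrices: "q \<in> matrices R k \<Longrightarrow> complement k q \<in> matrices R k"
  by (simp add: matrices_def complement_def R_diff_closed)

lemma mat_op_complement:
  assumes "q \<in> matrices R k" "F \<in> vecs"
  shows "mat_op (complement k q) F = trunc k F - mat_op q F"
proof (rule curry_eqI)
  fix i
  have "curry (mat_op q F) i = 0" if "\<not> i < k"
    using that assms by (simp add: mat_op_row matrices_zero[OF assms(1)])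
  moreover have "(\<Sum>l<k. (if i = l then \<one>\<^bsub>R\<^esub> else \<zero>\<^bsub>R\<^esub>) (curry F l) - q i l (curry F l))
      = curry F i - curry (mat_op q F) i" if "i < k"
  proof -
    have "(\<Sum>l<k. (if i = l then \<one>\<^bsub>R\<^esub> else \<zero>\<^bsub>R\<^esub>) (curry F l)) = (\<Sum>l<k. if i = l then curry F i else 0)"
      using assms(2) by (intro sum.cong refl) (simp add: R_simps)
    then show ?thesis
      using that by (simp add: sum_subtractf mat_op_row[OF assms])
  qed
  ultimately show "curry (mat_op (complement k q) F) i = curry (trunc k F - mat_op q F) i"
    using assms(2) unfolding mat_op_row[OF complement_matrices[OF assms(1)] assms(2)]
    by (simp add: complement_def)
qed

lemma idempotents_iff: "p \<in> idempotents R \<longleftrightarrow> p \<in> matrices_inf R \<and> mat_mult R p p = p"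
  by (auto simp: idempotents_def)

lemma idempotents_matrices [simp]: "p \<in> idempotents R \<Longrightarrow> p \<in> matrices_inf R"
  by (simp add: idempotents_iff)

lemma idempotent_op: "p \<in> idempotents R \<Longrightarrow> F \<in> vecs \<Longrightarrow> mat_op p (mat_op p F) = mat_op p F"
  using mat_op_mult[of p p F] by (simp add: idempotents_iff)

lemma idempotentI:
  assumes "p \<in> matrices_inf R" "\<And>F. F \<in> vecs \<Longrightarrow> mat_op p (mat_op p F) = mat_op p F"
  shows "p \<in> idempotents R"
  unfolding idempotents_iff using assms by (auto intro!: mat_op_eqI_vecs)

lemma alg_equivI:
  assumes "p \<in> matrices_inf R" "q \<in> matrices_inf R" "x \<in> matrices_inf R" "y \<in> matrices_inf R"
    and xy: "\<And>F. F \<in> vecs \<Longrightarrow> mat_op x (mat_op y F) = mat_op p F"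
    and yx: "\<And>F. F \<in> vecs \<Longrightarrow> mat_op y (mat_op x F) = mat_op q F"
    and p: "\<And>F. F \<in> vecs \<Longrightarrow> mat_op p (mat_op p F) = mat_op p F"
    and q: "\<And>F. F \<in> vecs \<Longrightarrow> mat_op q (mat_op q F) = mat_op q F"
  shows "(p, q) \<in> alg_equiv R"
proof -
  have "mat_mult R x y = p" "mat_mult R y x = q"
    using assms(1-4) by (auto intro!: mat_op_eqI_vecs simp: xy yx)
  then show ?thesis
    using assms idempotentI unfolding alg_equiv_def by blast
qed

text \<open>The matrices witnessing an equivalence can be chosen with \<open>p x = x = x q\<close> and \<open>q y = y = y p\<close>: replace
  arbitrary witnesses \<open>u\<close>, \<open>v\<close> by \<open>p u\<close> and \<open>q v\<close>, and use \<open>p u = u v u = u q\<close>.\<close>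

lemma alg_equivE:
  assumes "(p, q) \<in> alg_equiv R"
  obtains x y where "p \<in> idempotents R" "q \<in> idempotents R" "x \<in> matrices_inf R" "y \<in> matrices_inf R"
    and "\<And>F. F \<in> vecs \<Longrightarrow> mat_op x (mat_op y F) = mat_op p F"
    and "\<And>F. F \<in> vecs \<Longrightarrow> mat_op y (mat_op x F) = mat_op q F"
    and "\<And>F. F \<in> vecs \<Longrightarrow> mat_op p (mat_op x F) = mat_op x F"
    and "\<And>F. F \<in> vecs \<Longrightarrow> mat_op x (mat_op q F) = mat_op x F"
    and "\<And>F. F \<in> vecs \<Longrightarrow> mat_op q (mat_op y F) = mat_op y F"
    and "\<And>F. F \<in> vecs \<Longrightarrow> mat_op y (mat_op p F) = mat_op y F"
proof -
  obtain u v where uv: "u \<in> matrices_inf R" "v \<in> matrices_inf R"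
    and p: "p \<in> idempotents R" and q: "q \<in> idempotents R"
    and "mat_mult R u v = p" "mat_mult R v u = q"
    using assms by (auto simp: alg_equiv_def)
  then have P: "mat_op u (mat_op v F) = mat_op p F" and Q: "mat_op v (mat_op u F) = mat_op q F"
    if "F \<in> vecs" for F
    using mat_op_mult that by metis+
  note [simp] = uv idempotents_matrices[OF p] idempotents_matrices[OF q]
    idempotent_op[OF p] idempotent_op[OF q]
  have pu: "mat_op p (mat_op u F) = mat_op u (mat_op q F)" if "F \<in> vecs" for F
    using that by (simp flip: P Q)
  have qv: "mat_op q (mat_op v F) = mat_op v (mat_op p F)" if "F \<in> vecs" for F
    using that by (simp flip: P Q)
  define x y where "x = mat_mult R p u" and "y = mat_mult R q v"
  have x: "mat_op x F = mat_op p (mat_op u F)" and y: "mat_op y F = mat_op q (mat_op v F)"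
    if "F \<in> vecs" for F
    using that by (simp_all add: x_def y_def)
  show thesis
  proof (rule that[of x y])
    show "mat_op x (mat_op y F) = mat_op p F" if "F \<in> vecs" for F
      using that by (simp add: x y qv P)
    show "mat_op y (mat_op x F) = mat_op q F" if "F \<in> vecs" for F
      using that by (simp add: x y pu Q)
    show "mat_op x (mat_op q F) = mat_op x F" if "F \<in> vecs" for F
      using that by (simp add: x pu)
    show "mat_op y (mat_op p F) = mat_op y F" if "F \<in> vecs" for F
      using that by (simp add: y qv)
  qed (use p q in \<open>auto simp: x_def y_def\<close>)
qed

lemma alg_equiv_equiv: "equiv (idempotents R) (alg_equiv R)"
proof (rule equivI)
  show "alg_equiv R \<subseteq> idempotents R \<times> idempotents R"
    by (auto simp: alg_equiv_def)
  show "refl_on (idempotents R) (alg_equiv R)"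
    by (rule refl_onI) (auto simp: alg_equiv_def idempotents_iff)
  show "sym (alg_equiv R)"
    by (rule symI) (auto simp: alg_equiv_def)
  show "trans (alg_equiv R)"
  proof (rule transI)
    fix p q r assume pq: "(p, q) \<in> alg_equiv R" and qr: "(q, r) \<in> alg_equiv R"
    from pq show "(p, r) \<in> alg_equiv R"
    proof (rule alg_equivE)
      fix x y assume p: "p \<in> idempotents R" and xy: "x \<in> matrices_inf R" "y \<in> matrices_inf R"
        "\<And>F. F \<in> vecs \<Longrightarrow> mat_op x (mat_op y F) = mat_op p F"
        "\<And>F. F \<in> vecs \<Longrightarrow> mat_op y (mat_op x F) = mat_op q F"
        "\<And>F. F \<in> vecs \<Longrightarrow> mat_op q (mat_op y F) = mat_op y F"
      from qr show "(p, r) \<in> alg_equiv R"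
      proof (rule alg_equivE)
        fix u v assume r: "r \<in> idempotents R" and uv: "u \<in> matrices_inf R" "v \<in> matrices_inf R"
          "\<And>F. F \<in> vecs \<Longrightarrow> mat_op u (mat_op v F) = mat_op q F"
          "\<And>F. F \<in> vecs \<Longrightarrow> mat_op v (mat_op u F) = mat_op r F"
          "\<And>F. F \<in> vecs \<Longrightarrow> mat_op q (mat_op u F) = mat_op u F"
        show "(p, r) \<in> alg_equiv R"
          by (rule alg_equivI[of p r "mat_mult R x u" "mat_mult R v y"])
            (use p r in \<open>simp_all add: xy uv idempotent_op\<close>)
      qed
    qed
  qed
qed

text \<open>The hypotheses say that \<open>p\<close> and \<open>q\<close> have the same range on every fibre. Then \<open>p q = q\<close> and
  \<open>q p = p\<close>, and these two products witness the equivalence.\<close>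

lemma alg_equiv_of_same_range:
  assumes p: "p \<in> idempotents R" and q: "q \<in> idempotents R"
    and "\<And>w F. w \<in> unit_disc \<Longrightarrow> F \<in> fin_seqs (t w) \<Longrightarrow> mat_op p (mat_op q F) = mat_op q F"
    and "\<And>w F. w \<in> unit_disc \<Longrightarrow> F \<in> fin_seqs (t w) \<Longrightarrow> mat_op q (mat_op p F) = mat_op p F"
  shows "(p, q) \<in> alg_equiv R"
proof -
  have "mat_op (mat_mult R p q) F = mat_op q F" "mat_op (mat_mult R q p) F = mat_op p F"
    if "w \<in> unit_disc" "F \<in> fin_seqs (t w)" for w F
    using that p q assms(3,4)[OF that] fibre_seqs_subset[OF that(1)]
    by (auto simp: subset_iff)
  then have "mat_mult R p q = q" "mat_mult R q p = p"
    using p q by (auto intro!: mat_op_eqI)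
  then show ?thesis
    unfolding alg_equiv_def using p q idempotents_matrices by blast
qed

lemma mat_op_diag_sum:
  assumes "p \<in> matrices R k" "q \<in> matrices_inf R"
  shows "diag_sum R k p q \<in> matrices_inf R"
    and "F \<in> vecs \<Longrightarrow>
      mat_op (diag_sum R k p q) F = mat_op p F + shift_summands k (mat_op q (unshift k F))"
  unfolding diag_sum_block
  using block_op[OF matrices_infI[OF assms(1)] zero_mat_closed(2) zero_mat_closed(2) assms(2)]
    mat_op_trunc[OF assms(1)] trunc_mat_op[OF assms(1)]
  by simp_all

lemma mat_op_left_size:
  assumes "p \<in> matrices R k" "\<And>F. F \<in> vecs \<Longrightarrow> mat_op p (mat_op x F) = mat_op x F"
    and "x \<in> matrices_inf R" "F \<in> vecs"
  shows "trunc k (mat_op x F) = mat_op x F" "unshift k (mat_op x F) = 0"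
proof -
  show "trunc k (mat_op x F) = mat_op x F"
    using trunc_mat_op[OF assms(1), of "mat_op x F"] assms by simp
  then show "unshift k (mat_op x F) = 0"
    using seq_compose(3) by metis
qed

lemma mat_op_right_size:
  assumes "q \<in> matrices R k" "\<And>F. F \<in> vecs \<Longrightarrow> mat_op x (mat_op q F) = mat_op x F"
    and "x \<in> matrices_inf R" "F \<in> vecs"
  shows "mat_op x (trunc k F) = mat_op x F" "mat_op x (shift_summands k F) = 0"
proof -
  have *: "mat_op x (trunc k G) = mat_op x G" if "G \<in> vecs" for G
    using that assms(2)[of "trunc k G"] assms(2)[of G] mat_op_trunc[OF assms(1), of G] by simp
  then show "mat_op x (trunc k F) = mat_op x F" using assms(4) .
  show "mat_op x (shift_summands k F) = 0"
    using *[of "shift_summands k F"] assms(3,4) by simp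
qed

lemma diag_sum_idempotent:
  assumes "p \<in> idempotents R" "q \<in> idempotents R" "p \<in> matrices R k"
  shows "diag_sum R k p q \<in> idempotents R"
proof (rule idempotentI)
  note pq = mat_op_diag_sum[OF assms(3) idempotents_matrices[OF assms(2)]]
  show "diag_sum R k p q \<in> matrices_inf R" by (rule pq)
  fix F assume "F \<in> vecs"
  then show "mat_op (diag_sum R k p q) (mat_op (diag_sum R k p q) F) = mat_op (diag_sum R k p q) F"
    using assms mat_op_left_size[OF assms(3) idempotent_op[OF assms(1)]]
      mat_op_right_size[OF assms(3) idempotent_op[OF assms(1)]]
    by (simp add: pq idempotent_op)
qed

text \<open>Addition of classes is well defined: if \<open>x\<close>, \<open>y\<close> and \<open>u\<close>, \<open>v\<close> witness the two equivalences, then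
  \<open>diag(x, u)\<close> and \<open>diag(y, v)\<close> witness that of the sums. The blocks \<open>x\<close> and \<open>y\<close> are rectangular when
  \<open>p\<close> and \<open>p'\<close> are given different sizes; they fit because \<open>x = p x p'\<close> and \<open>y = p' y p\<close>.\<close>

lemma diag_sum_cong:
  assumes pp: "(p, p') \<in> alg_equiv R" and qq: "(q, q') \<in> alg_equiv R"
    and k: "p \<in> matrices R k" and k': "p' \<in> matrices R k'"
  shows "(diag_sum R k p q, diag_sum R k' p' q') \<in> alg_equiv R"
  using pp
proof (rule alg_equivE)
  fix x y assume p: "p \<in> idempotents R" "p' \<in> idempotents R"
    and [simp]: "x \<in> matrices_inf R" "y \<in> matrices_inf R"
    and xy: "\<And>F. F \<in> vecs \<Longrightarrow> mat_op x (mat_op y F) = mat_op p F"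
    "\<And>F. F \<in> vecs \<Longrightarrow> mat_op y (mat_op x F) = mat_op p' F"
    and *: "\<And>F. F \<in> vecs \<Longrightarrow> mat_op p (mat_op x F) = mat_op x F"
    "\<And>F. F \<in> vecs \<Longrightarrow> mat_op x (mat_op p' F) = mat_op x F"
    "\<And>F. F \<in> vecs \<Longrightarrow> mat_op p' (mat_op y F) = mat_op y F"
    "\<And>F. F \<in> vecs \<Longrightarrow> mat_op y (mat_op p F) = mat_op y F"
  note size [simp] = mat_op_left_size[OF k *(1)] mat_op_right_size[OF k' *(2)]
    mat_op_left_size[OF k' *(3)] mat_op_right_size[OF k *(4)]
  from qq show ?thesis
  proof (rule alg_equivE)
    fix u v assume q: "q \<in> idempotents R" "q' \<in> idempotents R"
      and [simp]: "u \<in> matrices_inf R" "v \<in> matrices_inf R"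
      and uv: "\<And>F. F \<in> vecs \<Longrightarrow> mat_op u (mat_op v F) = mat_op q F"
      "\<And>F. F \<in> vecs \<Longrightarrow> mat_op v (mat_op u F) = mat_op q' F"
    note pq = mat_op_diag_sum[OF k idempotents_matrices[OF q(1)]]
      mat_op_diag_sum[OF k' idempotents_matrices[OF q(2)]]
    note X = block_op[where a = x and b = zero_mat and c = zero_mat and d = u]
      and Y = block_op[where a = y and b = zero_mat and c = zero_mat and d = v]
    show ?thesis
    proof (rule alg_equivI[of _ _ "block k k' x zero_mat zero_mat u" "block k' k y zero_mat zero_mat v"])
      show "mat_op (diag_sum R k p q) (mat_op (diag_sum R k p q) F) = mat_op (diag_sum R k p q) F"
        "mat_op (diag_sum R k' p' q') (mat_op (diag_sum R k' p' q') F) = mat_op (diag_sum R k' p' q') F"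
        if "F \<in> vecs" for F
        using that diag_sum_idempotent[OF p(1) q(1) k] diag_sum_idempotent[OF p(2) q(2) k']
        by (simp_all add: idempotent_op)
    qed (simp_all add: X Y pq xy uv trunc_mat_op[OF k] trunc_mat_op[OF k'])
  qed
qed

section \<open>Operators on powers of the curve\<close>

lemma matrices_sizeI:
  assumes a: "a \<in> matrices_inf R"
    and row: "\<And>F. F \<in> vecs \<Longrightarrow> trunc k (mat_op a F) = mat_op a F"
    and col: "\<And>F. F \<in> vecs \<Longrightarrow> mat_op a (trunc k F) = mat_op a F"
  shows "a \<in> matrices R k"
proof -
  have "a i j = \<zero>\<^bsub>R\<^esub>" if ij: "k \<le> i \<or> k \<le> j" for i j
  proof (rule R_eqI[OF matrices_inf_carrier[OF a] R_zero_closed])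
    fix v assume v: "v \<in> vec H"
    have "a i j v = curry (trunc k (mat_op a (trunc k (in_summand j v)))) i"
      using v by (simp add: row col a mat_op_in_summand)
    also have "trunc k (mat_op a (trunc k (in_summand j v))) = 0" if "k \<le> j"
    proof -
      have "trunc k (in_summand j v) = 0" using that by (intro curry_eqI) simp
      then show ?thesis using a by simp
    qed
    ultimately show "a i j v = \<zero>\<^bsub>R\<^esub> v"
      using ij v by (cases "k \<le> j") simp_all
  qed
  then show ?thesis using matrices_inf_carrier[OF a] unfolding matrices_def by blast
qed

lemma Hpow_vecs: "F \<in> Hpow m \<Longrightarrow> F \<in> vecs" and Hpow_trunc: "F \<in> Hpow m \<Longrightarrow> trunc m F = F"
  and trunc_Hpow: "F \<in> vecs \<Longrightarrow> trunc m F \<in> Hpow m"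
  by (simp_all add: Hpow_iff)

lemma fibre_power_subset: "w \<in> unit_disc \<Longrightarrow> curve_power m t w \<subseteq> Hpow m"
  using fibre_seqs_subset[of w] by (auto simp: fibre_power_iff Hpow_iff)

lemma mat_op_Hpow: "a \<in> matrices R m \<Longrightarrow> F \<in> vecs \<Longrightarrow> mat_op a F \<in> Hpow m"
  by (simp add: Hpow_iff trunc_mat_op matrices_infI)

lemma power_simps:
  "A \<in> carrier (power_algebra H t m) \<longleftrightarrow>
    A \<in> bounded_ops (dsum_space m (\<lambda>_. H)) \<and> (\<forall>w\<in>unit_disc. A ` curve_power m t w \<subseteq> curve_power m t w)"
  "A \<otimes>\<^bsub>power_algebra H t m\<^esub> B = compose (Hpow m) A B"
  "\<one>\<^bsub>power_algebra H t m\<^esub> = (\<lambda>v\<in>Hpow m. v)"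
  by (simp_all add: curve_algebra_def)

lemma hnorm_component:
  assumes "F \<in> vecs" "i < m"
  shows "hnorm H (curry F i) \<le> hnorm (dsum_space m (\<lambda>_. H)) F"
  unfolding hnorm_dsum[OF vecs_curry[OF assms(1)]]
  using assms by (intro member_le_L2_set) auto

text \<open>The norm of a sequence lies between the norm of any of its components and the sum of the norms of
  all of them; so the sum of bounds for the entries bounds the matrix.\<close>

lemma mat_op_bounded:
  assumes "a \<in> matrices R m"
  shows "\<exists>C. \<forall>F\<in>Hpow m. hnorm (dsum_space m (\<lambda>_. H)) (mat_op a F) \<le> C * hnorm (dsum_space m (\<lambda>_. H)) F"
proof -
  have "\<forall>i l. \<exists>C\<ge>0. \<forall>v\<in>vec H. hnorm H (a i l v) \<le> C * hnorm H v"
    using R_bounded[OF matrices_carrier[OF assms]] by blast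
  then obtain C where C: "\<And>i l. C i l \<ge> (0::real)"
    "\<And>i l v. v \<in> vec H \<Longrightarrow> hnorm H (a i l v) \<le> C i l * hnorm H v"
    by metis
  let ?N = "hnorm (dsum_space m (\<lambda>_. H))"
  have "?N (mat_op a F) \<le> (\<Sum>i<m. \<Sum>l<m. C i l) * ?N F" if "F \<in> Hpow m" for F
  proof -
    have F: "F \<in> vecs" using that by (rule Hpow_vecs)
    have aF: "mat_op a F \<in> vecs" using assms F by (simp add: matrices_infI)
    have "?N (mat_op a F) \<le> (\<Sum>i<m. hnorm H (curry (mat_op a F) i))"
      unfolding hnorm_dsum[OF vecs_curry[OF aF]]
      using aF by (intro L2_set_le_sum hnorm_nonneg vecs_curry)
    also have "\<dots> \<le> (\<Sum>i<m. \<Sum>l<m. hnorm H (a i l (curry F l)))"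
      unfolding mat_op_row[OF assms F]
      by (intro sum_mono hnorm_sum) (simp add: R_closed[OF matrices_carrier[OF assms]] F)
    also have "\<dots> \<le> (\<Sum>i<m. \<Sum>l<m. C i l * ?N F)"
      using C F hnorm_component[OF F]
      by (intro sum_mono order_trans[OF C(2)] mult_left_mono) auto
    finally show ?thesis by (simp add: sum_distrib_right)
  qed
  then show ?thesis by blast
qed

lemma mat_op_power:
  assumes "a \<in> matrices R m"
  shows "restrict (mat_op a) (Hpow m) \<in> carrier (power_algebra H t m)"
proof -
  have "F + G \<in> Hpow m" "fscale c F \<in> Hpow m" if "F \<in> Hpow m" "G \<in> Hpow m" for F G c
  proof -
    show "F + G \<in> Hpow m" using that by (simp add: Hpow_iff)
    have "trunc m (fscale c F) = fscale c (trunc m F)"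
      by (rule curry_eqI) simp
    then show "fscale c F \<in> Hpow m" using that by (simp add: Hpow_iff vecs_scale)
  qed
  then have "restrict (mat_op a) (Hpow m) \<in> bounded_ops (dsum_space m (\<lambda>_. H))"
    using mat_op_bounded[OF assms] assms
    by (auto simp: bounded_ops_def mat_op_Hpow Hpow_vecs matrices_infI mat_op_scale[OF assms])
  moreover have "restrict (mat_op a) (Hpow m) ` curve_power m t w \<subseteq> curve_power m t w"
    if w: "w \<in> unit_disc" for w
  proof (rule image_subsetI)
    fix F assume F: "F \<in> curve_power m t w"
    then have "F \<in> Hpow m" "F \<in> fin_seqs (t w)"
      using fibre_power_subset[OF w] fibre_power_iff[OF w] by blast+
    then show "restrict (mat_op a) (Hpow m) F \<in> curve_power m t w"
      using w assms by (simp add: fibre_power_iff mat_op_fibre matrices_infI trunc_mat_op Hpow_vecs)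
  qed
  ultimately show ?thesis by (simp add: power_simps)
qed

text \<open>Together with the previous lemma, this identifies the algebra of the \<open>m\<close>-th power of the curve with
  the \<open>m \<times> m\<close> matrices over the algebra of the curve. The entries are the compressions of the operator to
  pairs of summands.\<close>

lemma power_mat_op:
  assumes A: "A \<in> carrier (power_algebra H t m)"
  obtains a where "a \<in> matrices R m" "\<And>F. F \<in> Hpow m \<Longrightarrow> A F = mat_op a F"
proof -
  have Hp: "A F \<in> Hpow m" if "F \<in> Hpow m" for F
    using A that by (auto simp: power_simps bounded_ops_def)
  have add: "A (F + G) = A F + A G" if "F \<in> Hpow m" "G \<in> Hpow m" for F G
    using A that by (auto simp: power_simps bounded_ops_def)
  have scale: "A (fscale c F) = fscale c (A F)" if "F \<in> Hpow m" for F c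
    using A that by (auto simp: power_simps bounded_ops_def)
  have fibre: "A F \<in> curve_power m t w" if "w \<in> unit_disc" "F \<in> curve_power m t w" for w F
    using A that unfolding power_simps(1) by blast
  obtain C where C: "hnorm (dsum_space m (\<lambda>_. H)) (A F) \<le> C * hnorm (dsum_space m (\<lambda>_. H)) F"
    if "F \<in> Hpow m" for F
    using A unfolding power_simps(1) bounded_ops_def by blast
  define a where "a = (\<lambda>i j. if i < m \<and> j < m then \<lambda>v\<in>vec H. curry (A (in_summand j v)) i else \<zero>\<^bsub>R\<^esub>)"
  have trunc_in: "trunc m (in_summand j v) = in_summand j v" if "j < m" for j and v :: "'x \<Rightarrow> complex"
    using that by (intro curry_eqI) simp
  then have in_Hp: "in_summand j v \<in> Hpow m" if "j < m" "v \<in> vec H" for j v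
    using that by (simp add: Hpow_iff)
  have "(\<lambda>v\<in>vec H. curry (A (in_summand j v)) i) \<in> carrier R" if ij: "i < m" "j < m" for i j
  proof (rule R_carrierI[where C = C])
    fix v assume v: "v \<in> vec H"
    note mem = in_Hp[OF ij(2) v]
    show "curry (A (in_summand j v)) i \<in> vec H"
      by (rule vecs_curry[OF Hpow_vecs[OF Hp[OF mem]]])
    show "curry (A (in_summand j (fscale c v))) i = fscale c (curry (A (in_summand j v)) i)" for c
    proof -
      have "in_summand j (fscale c v) = fscale c (in_summand j v)"
        by (rule curry_eqI) simp
      then show ?thesis using mem by (simp add: scale)
    qed
    have "hnorm H (curry (A (in_summand j v)) i) \<le> hnorm (dsum_space m (\<lambda>_. H)) (A (in_summand j v))"
      by (rule hnorm_component[OF Hpow_vecs[OF Hp[OF mem]] ij(1)])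
    also have "\<dots> \<le> C * hnorm (dsum_space m (\<lambda>_. H)) (in_summand j v)"
      using mem by (rule C)
    also have "hnorm (dsum_space m (\<lambda>_. H)) (in_summand j v) = hnorm H v"
    proof -
      have "hnorm (dsum_space m (\<lambda>_. H)) (in_summand j v)
          = sqrt (\<Sum>i<m. if i = j then (hnorm H v)\<^sup>2 else 0)"
        unfolding hnorm_dsum[OF vecs_curry[OF Hpow_vecs[OF mem]]] L2_set_def
        using hnorm_eq_0[OF vec_0] by (intro arg_cong[of _ _ sqrt] sum.cong) auto
      then show ?thesis using ij v by (simp add: hnorm_nonneg)
    qed
    finally show "hnorm H (curry (A (in_summand j v)) i) \<le> C * hnorm H v" .
    fix u assume u: "u \<in> vec H"
    have "in_summand j (u + v) = in_summand j u + in_summand j v"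
      by (rule curry_eqI) simp
    then show "curry (A (in_summand j (u + v))) i
        = curry (A (in_summand j u)) i + curry (A (in_summand j v)) i"
      using mem in_Hp[OF ij(2) u] by (simp add: add)
  next
    fix w v assume w: "w \<in> unit_disc" and v: "v \<in> t w"
    then have "in_summand j v \<in> curve_power m t w"
      using ij(2) by (simp add: fibre_power_iff fibre_seq_mem trunc_in)
    then show "curry (A (in_summand j v)) i \<in> t w"
      using fibre[OF w] ij(1) by (auto simp: curve_power_def)
  qed
  then have a: "a \<in> matrices R m"
    unfolding matrices_def a_def by auto
  have "A F = mat_op a F" if F: "F \<in> Hpow m" for F
  proof -
    have Fv: "F \<in> vecs" using F by (rule Hpow_vecs)
    have comp: "in_summand j (curry F j) \<in> Hpow m" if "j < m" for j
      using that Fv by (intro in_Hp vecs_curry)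
    have "trunc k F \<in> Hpow m \<and> A (trunc k F) = (\<Sum>j<k. A (in_summand j (curry F j)))" if "k \<le> m" for k
      using that
    proof (induction k)
      case 0
      have "trunc 0 F = 0" by (rule curry_eqI) simp
      moreover have "A 0 = 0" "0 \<in> Hpow m"
        using add[of 0 0] by (simp_all add: Hpow_iff)
      ultimately show ?case unfolding lessThan_0 sum.empty by metis
    next
      case (Suc k)
      then have IH: "trunc k F \<in> Hpow m" "A (trunc k F) = (\<Sum>j<k. A (in_summand j (curry F j)))"
        using Suc_leD[OF Suc.prems] by blast+
      have "trunc (Suc k) F = trunc k F + in_summand k (curry F k)"
        by (rule curry_eqI) (simp add: less_Suc_eq)
      moreover have "trunc k F + in_summand k (curry F k) \<in> Hpow m"
        using IH(1) comp[of k] Suc.prems by (simp add: Hpow_iff)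
      moreover have "A (trunc k F + in_summand k (curry F k))
          = (\<Sum>j<k. A (in_summand j (curry F j))) + A (in_summand k (curry F k))"
        using add[OF IH(1) comp[of k]] IH(2) Suc.prems by (metis Suc_le_lessD)
      ultimately show ?case unfolding sum.lessThan_Suc by metis
    qed
    then have sum: "A F = (\<Sum>j<m. A (in_summand j (curry F j)))"
      using Hpow_trunc[OF F] by (metis order_refl)
    show ?thesis
    proof (rule curry_eqI)
      fix i
      have curry_sum: "curry (\<Sum>j\<in>J. f j) i = (\<Sum>j\<in>J. curry (f j) i)"
        for J and f :: "nat \<Rightarrow> nat \<times> 'x \<Rightarrow> complex"
        by (induction J rule: infinite_finite_induct) (simp_all del: curry_conv plus_fun_apply zero_fun_apply)
      show "curry (A F) i = curry (mat_op a F) i"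
      proof (cases "i < m")
        case True
        then show ?thesis
          unfolding sum curry_sum mat_op_row[OF a Fv] using Fv by (intro sum.cong) (simp_all add: a_def)
      next
        case False
        then show ?thesis
          using trunc_mat_op[OF a Fv] Hpow_trunc[OF Hp[OF F]] unfolding trunc_eq_iff by simp
      qed
    qed
  qed
  with a show thesis by (rule that)
qed

section \<open>Sub-bundles and idempotents\<close>

text \<open>Since a matrix of size \<open>m\<close> ignores all components from \<open>m\<close> on, taking the images of arbitrarily long
  sequences gives the same fibres as taking those of the \<open>m\<close>-th power, for every admissible \<open>m\<close>.\<close>

definition range_bundle ::
  "(nat \<Rightarrow> nat \<Rightarrow> ('x \<Rightarrow> complex) \<Rightarrow> ('x \<Rightarrow> complex)) \<Rightarrow> complex \<Rightarrow> (nat \<times> 'x \<Rightarrow> complex) set" where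
  "range_bundle p = (\<lambda>w\<in>unit_disc. mat_op p ` fin_seqs (t w))"

lemma image_fibre_power:
  assumes "a \<in> matrices R m" "w \<in> unit_disc" "\<And>F. F \<in> Hpow m \<Longrightarrow> A F = mat_op a F"
  shows "A ` curve_power m t w = mat_op a ` fin_seqs (t w)"
proof
  show "A ` curve_power m t w \<subseteq> mat_op a ` fin_seqs (t w)"
  proof (rule image_subsetI)
    fix F assume "F \<in> curve_power m t w"
    then have "F \<in> Hpow m" "F \<in> fin_seqs (t w)"
      using fibre_power_subset[OF assms(2)] fibre_power_iff[OF assms(2)] by blast+
    then show "A F \<in> mat_op a ` fin_seqs (t w)" using assms(3) by simp
  qed
  show "mat_op a ` fin_seqs (t w) \<subseteq> A ` curve_power m t w"
  proof (rule image_subsetI)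
    fix F assume F: "F \<in> fin_seqs (t w)"
    then have "trunc m F \<in> curve_power m t w"
      using assms(2) by (simp add: fibre_power_iff fibre_seq_mem)
    moreover have "mat_op a F = A (trunc m F)"
      using F assms fibre_seqs_subset[OF assms(2)]
      by (simp add: trunc_Hpow mat_op_trunc subset_iff)
    ultimately show "mat_op a F \<in> A ` curve_power m t w" by blast
  qed
qed

lemma range_bundle_subbundle:
  assumes p: "p \<in> idempotents R" and m: "p \<in> matrices R m"
  shows "range_bundle p \<in> subbundles H t m"
proof -
  let ?P = "restrict (mat_op p) (Hpow m)"
  have "?P \<in> carrier (power_algebra H t m)" by (rule mat_op_power[OF m])
  moreover have "?P \<otimes>\<^bsub>power_algebra H t m\<^esub> ?P = ?P"
    unfolding power_simps by (rule ext)
      (simp add: compose_def mat_op_Hpow[OF m] Hpow_vecs idempotent_op[OF p])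
  moreover have "range_bundle p = (\<lambda>w\<in>unit_disc. ?P ` curve_power m t w)"
    unfolding range_bundle_def by (intro restrict_ext image_fibre_power[OF m, symmetric]) simp_all
  ultimately show ?thesis unfolding subbundles_def by blast
qed

lemma subbundleE:
  assumes "E \<in> subbundles H t m"
  obtains p where "p \<in> idempotents R" "p \<in> matrices R m" "E = range_bundle p"
proof -
  obtain P where P: "P \<in> carrier (power_algebra H t m)"
    and PP: "compose (Hpow m) P P = P" and E: "E = (\<lambda>w\<in>unit_disc. P ` curve_power m t w)"
    using assms by (auto simp: subbundles_def power_simps)
  obtain p where p: "p \<in> matrices R m" "\<And>F. F \<in> Hpow m \<Longrightarrow> P F = mat_op p F"
    using power_mat_op[OF P] by blast
  have "p \<in> idempotents R"
  proof (rule idempotentI)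
    show "p \<in> matrices_inf R" using p(1) by (rule matrices_infI)
    fix F assume F: "F \<in> vecs"
    have "P (P (trunc m F)) = P (trunc m F)"
      using PP trunc_Hpow[OF F, of m] by (metis compose_eq)
    then show "mat_op p (mat_op p F) = mat_op p F"
      using F p by (simp add: trunc_Hpow mat_op_trunc mat_op_Hpow)
  qed
  moreover have "E = range_bundle p"
    unfolding E range_bundle_def by (rule restrict_ext) (simp add: image_fibre_power[OF p(1) _ p(2)])
  ultimately show thesis using p(1) that by blast
qed

lemma range_bundle_eqD:
  assumes p: "p \<in> idempotents R" and q: "q \<in> idempotents R" and eq: "range_bundle p = range_bundle q"
  shows "(p, q) \<in> alg_equiv R"
proof (rule alg_equiv_of_same_range[OF p q])
  fix w F assume w: "w \<in> unit_disc" and F: "F \<in> fin_seqs (t w)"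
  have im: "mat_op p ` fin_seqs (t w) = mat_op q ` fin_seqs (t w)"
    using fun_cong[OF eq, of w] w by (simp add: range_bundle_def)
  have fixed: "mat_op r G = G" if "r \<in> idempotents R" "G \<in> mat_op r ` fin_seqs (t w)" for r G
    using that fibre_seqs_subset[OF w] by (auto simp: idempotent_op subset_iff)
  show "mat_op p (mat_op q F) = mat_op q F" "mat_op q (mat_op p F) = mat_op p F"
    using F im by (intro fixed p q; blast)+
qed

text \<open>With normalised witnesses \<open>x\<close>, \<open>y\<close>, the block matrices
  \<open>V = (y, 1 - q; 1 - p, x)\<close> and \<open>W = (x, 1 - p; 1 - q, y)\<close> are inverse to each other, and \<open>V\<close> maps
  \<open>(p F, 0)\<close> to \<open>(y F, 0)\<close>, because \<open>y p = y\<close> and \<open>(1 - p) p = 0\<close>. The ranges of \<open>y\<close> and of \<open>q\<close> agree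
  by \<open>y = q y\<close> and \<open>q = y x\<close>.\<close>

lemma alg_equiv_imp_similar:
  assumes "(p, q) \<in> alg_equiv R"
  shows "(range_bundle p, range_bundle q) \<in> bundle_similar H t"
  using assms
proof (rule alg_equivE)
  fix x y assume p: "p \<in> idempotents R" and q: "q \<in> idempotents R"
    and [simp]: "x \<in> matrices_inf R" "y \<in> matrices_inf R"
    and xy [simp]: "\<And>F. F \<in> vecs \<Longrightarrow> mat_op x (mat_op y F) = mat_op p F"
    and yx [simp]: "\<And>F. F \<in> vecs \<Longrightarrow> mat_op y (mat_op x F) = mat_op q F"
    and px [simp]: "\<And>F. F \<in> vecs \<Longrightarrow> mat_op p (mat_op x F) = mat_op x F"
    and xq [simp]: "\<And>F. F \<in> vecs \<Longrightarrow> mat_op x (mat_op q F) = mat_op x F"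
    and qy [simp]: "\<And>F. F \<in> vecs \<Longrightarrow> mat_op q (mat_op y F) = mat_op y F"
    and yp [simp]: "\<And>F. F \<in> vecs \<Longrightarrow> mat_op y (mat_op p F) = mat_op y F"
  obtain k where k: "p \<in> matrices R k" "q \<in> matrices R k" "1 \<le> k"
    using common_size[OF idempotents_matrices[OF p] idempotents_matrices[OF q]] .
  note [simp] = idempotents_matrices[OF p] idempotents_matrices[OF q]
    idempotent_op[OF p] idempotent_op[OF q]
  note [simp] =
    mat_op_left_size[OF k(1) px] mat_op_left_size[OF k(2) qy]
    mat_op_right_size[OF k(2) xq] mat_op_right_size[OF k(1) yp]
    mat_op_left_size[OF k(1) idempotent_op[OF p]] mat_op_left_size[OF k(2) idempotent_op[OF q]]
    mat_op_right_size[OF k(1) idempotent_op[OF p]] mat_op_right_size[OF k(2) idempotent_op[OF q]]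
  note [simp] = mat_op_complement[OF k(1)] mat_op_complement[OF k(2)]
    matrices_infI[OF complement_matrices[OF k(1)]] matrices_infI[OF complement_matrices[OF k(2)]]
  define V where "V = block k k y (complement k q) (complement k p) x"
  define W where "W = block k k x (complement k p) (complement k q) y"
  have V: "V \<in> matrices_inf R" "\<And>F. F \<in> vecs \<Longrightarrow> mat_op V F =
      mat_op y F + (trunc k (unshift k F) - mat_op q (unshift k F))
      + shift_summands k ((trunc k F - mat_op p F) + mat_op x (unshift k F))"
    unfolding V_def by (simp_all add: block_op)
  have W: "W \<in> matrices_inf R" "\<And>F. F \<in> vecs \<Longrightarrow> mat_op W F =
      mat_op x F + (trunc k (unshift k F) - mat_op p (unshift k F))
      + shift_summands k ((trunc k F - mat_op q F) + mat_op y (unshift k F))"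
    unfolding W_def by (simp_all add: block_op)
  have VW: "mat_op V (mat_op W F) = trunc (k + k) F" and WV: "mat_op W (mat_op V F) = trunc (k + k) F"
    if "F \<in> vecs" for F
    using that by (simp_all add: V W flip: trunc_plus_shift)
  have left: "trunc (k + k) (mat_op V F) = mat_op V F" "trunc (k + k) (mat_op W F) = mat_op W F"
    if "F \<in> vecs" for F
    using that by (simp_all add: V W flip: trunc_plus_shift)
  \<comment> \<open>As \<open>V = V W V\<close> and \<open>W V\<close> is truncation, \<open>V\<close> ignores the components from \<open>2 k\<close> on; so does \<open>W\<close>.\<close>
  have right: "mat_op V (trunc (k + k) F) = mat_op V F" "mat_op W (trunc (k + k) F) = mat_op W F"
    if "F \<in> vecs" for F
    using that left V(1) W(1) by (metis VW WV mat_op_closed)+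
  let ?m = "k + k"
  have size: "V \<in> matrices R ?m" "W \<in> matrices R ?m"
    using left right V(1) W(1) by (simp_all add: matrices_sizeI)
  let ?X = "restrict (mat_op V) (Hpow ?m)" and ?Y = "restrict (mat_op W) (Hpow ?m)"
  have "?X \<in> Units (power_algebra H t ?m)"
  proof -
    have "compose (Hpow ?m) ?X ?Y = (\<lambda>F\<in>Hpow ?m. F)" "compose (Hpow ?m) ?Y ?X = (\<lambda>F\<in>Hpow ?m. F)"
      using mat_op_Hpow[OF size(1)] mat_op_Hpow[OF size(2)]
      by (auto simp: compose_def fun_eq_iff Hpow_vecs Hpow_trunc VW WV)
    then show ?thesis
      unfolding Units_def using mat_op_power[OF size(1)] mat_op_power[OF size(2)]
      by (auto simp: power_simps(2,3))
  qed
  moreover have "?X ` range_bundle p w = range_bundle q w" if w: "w \<in> unit_disc" for w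
  proof -
    have mem: "F \<in> vecs" if "F \<in> fin_seqs (t w)" for F
      using that fibre_seqs_subset[OF w] by blast
    have "mat_op p F \<in> Hpow ?m" if "F \<in> vecs" for F
      using that by (intro mat_op_Hpow matrices_mono[OF k(1)]) simp_all
    then have Xp: "?X (mat_op p F) = mat_op y F" if "F \<in> fin_seqs (t w)" for F
      using mem[OF that] by (simp add: V)
    have "range_bundle p w = mat_op p ` fin_seqs (t w)"
      using w by (simp add: range_bundle_def)
    then have "?X ` range_bundle p w = mat_op y ` fin_seqs (t w)"
      by (simp only: image_image Xp cong: image_cong)
    also have "\<dots> = mat_op q ` fin_seqs (t w)"
    proof
      show "mat_op y ` fin_seqs (t w) \<subseteq> mat_op q ` fin_seqs (t w)"
      proof (rule image_subsetI)
        fix F assume F: "F \<in> fin_seqs (t w)"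
        show "mat_op y F \<in> mat_op q ` fin_seqs (t w)"
          by (rule image_eqI[where x = "mat_op y F"]) (simp_all add: mem[OF F] mat_op_fibre[OF _ w F])
      qed
      show "mat_op q ` fin_seqs (t w) \<subseteq> mat_op y ` fin_seqs (t w)"
      proof (rule image_subsetI)
        fix F assume F: "F \<in> fin_seqs (t w)"
        show "mat_op q F \<in> mat_op y ` fin_seqs (t w)"
          by (rule image_eqI[where x = "mat_op x F"]) (simp_all add: mem[OF F] mat_op_fibre[OF _ w F])
      qed
    qed
    finally show ?thesis using w by (simp add: range_bundle_def)
  qed
  moreover have "range_bundle p \<in> subbundles H t ?m" "range_bundle q \<in> subbundles H t ?m"
    using p q k(1,2) by (auto intro!: range_bundle_subbundle intro: matrices_mono)
  moreover have "1 \<le> ?m" using k(3) by simp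
  ultimately show ?thesis unfolding bundle_similar_def by blast
qed

text \<open>An invertible \<open>X\<close> mapping the range bundle of \<open>p\<close> onto that of \<open>q\<close> turns \<open>p\<close> into the
  idempotent \<open>r = X p X\<^sup>-\<^sup>1\<close>, which has the same range bundle as \<open>q\<close>; and \<open>p = (p X\<^sup>-\<^sup>1) (X p)\<close> is
  algebraically equivalent to \<open>r\<close>.\<close>

lemma similar_imp_alg_equiv:
  assumes p: "p \<in> idempotents R" and q: "q \<in> idempotents R"
    and sim: "(range_bundle p, range_bundle q) \<in> bundle_similar H t"
  shows "(p, q) \<in> alg_equiv R"
proof -
  obtain m X where m: "range_bundle p \<in> subbundles H t m"
    and X: "X \<in> Units (power_algebra H t m)"
    and map: "\<And>w. w \<in> unit_disc \<Longrightarrow> X ` range_bundle p w = range_bundle q w"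
    using sim unfolding bundle_similar_def by blast
  obtain p' where p': "p' \<in> idempotents R" "p' \<in> matrices R m" "range_bundle p = range_bundle p'"
    using subbundleE[OF m] by blast
  obtain Y where XY: "X \<in> carrier (power_algebra H t m)" "Y \<in> carrier (power_algebra H t m)"
    "compose (Hpow m) Y X = (\<lambda>F\<in>Hpow m. F)"
    using X unfolding Units_def power_simps(2,3) by blast
  obtain x where x: "x \<in> matrices R m" "\<And>F. F \<in> Hpow m \<Longrightarrow> X F = mat_op x F"
    using power_mat_op[OF XY(1)] by blast
  obtain y where y: "y \<in> matrices R m" "\<And>F. F \<in> Hpow m \<Longrightarrow> Y F = mat_op y F"
    using power_mat_op[OF XY(2)] by blast
  note [simp] = matrices_infI[OF x(1)] matrices_infI[OF y(1)] idempotents_matrices[OF p'(1)]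
    idempotent_op[OF p'(1)] mat_op_Hpow[OF p'(2)]
  have yx: "mat_op y (mat_op x F) = F" if "F \<in> Hpow m" for F
    using fun_cong[OF XY(3), of F] that x y by (simp add: compose_eq mat_op_Hpow Hpow_vecs)
  define r where "r = mat_mult R x (mat_mult R p' y)"
  have r: "mat_op r F = mat_op x (mat_op p' (mat_op y F))" if "F \<in> vecs" for F
    using that by (simp add: r_def)
  have pr: "(p', r) \<in> alg_equiv R"
    by (rule alg_equivI[of _ _ "mat_mult R p' y" "mat_mult R x p'"])
      (simp_all add: r_def yx)
  have "(r, q) \<in> alg_equiv R"
  proof (rule alg_equiv_of_same_range)
    show "r \<in> idempotents R" using pr by (simp add: alg_equiv_def)
    fix w F assume w: "w \<in> unit_disc" and F: "F \<in> fin_seqs (t w)"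
    have vec: "F \<in> vecs" using F fibre_seqs_subset[OF w] by blast
    have im: "mat_op x ` mat_op p' ` fin_seqs (t w) = mat_op q ` fin_seqs (t w)"
    proof -
      have "X ` mat_op p' ` fin_seqs (t w) = mat_op x ` mat_op p' ` fin_seqs (t w)"
        using fibre_seqs_subset[OF w] x(2) by (intro image_cong) auto
      then show ?thesis using map[OF w, unfolded p'(3)] w by (simp add: range_bundle_def)
    qed
    obtain G where G: "G \<in> fin_seqs (t w)" "mat_op q F = mat_op x (mat_op p' G)"
      using im F by blast
    then show "mat_op r (mat_op q F) = mat_op q F"
      using fibre_seqs_subset[OF w] by (simp add: r yx subset_iff)
    obtain G where G: "G \<in> fin_seqs (t w)" "mat_op x (mat_op p' (mat_op y F)) = mat_op q G"
      using im mat_op_fibre[OF _ w F, of y] by fastforce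
    then show "mat_op q (mat_op r F) = mat_op r F"
      using fibre_seqs_subset[OF w] vec by (simp add: r idempotent_op[OF q] subset_iff)
  qed (rule q)
  moreover have "(p, p') \<in> alg_equiv R"
    by (rule range_bundle_eqD[OF p p'(1) p'(3)])
  ultimately show ?thesis
    using pr alg_equiv_equiv unfolding equiv_def by (meson transD)
qed

section \<open>The two K-groups\<close>

text \<open>A pair of sequences, the first of which matters only up to \<open>k\<close>, is the same as one sequence cut at
  \<open>k\<close>.\<close>

lemma range_bundle_diag_sum:
  assumes p: "p \<in> matrices R k" and q: "q \<in> matrices_inf R"
  shows "bundle_sum k (range_bundle p) (range_bundle q) = range_bundle (diag_sum R k p q)"
  unfolding bundle_sum_def range_bundle_def[of "diag_sum R k p q"]
proof (rule restrict_ext)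
  fix w assume w: "w \<in> unit_disc"
  have mem: "F \<in> vecs" if "F \<in> fin_seqs (t w)" for F
    using that fibre_seqs_subset[OF w] by blast
  have "{u + shift_summands k v | u v. u \<in> mat_op p ` fin_seqs (t w) \<and> v \<in> mat_op q ` fin_seqs (t w)}
      = mat_op (diag_sum R k p q) ` fin_seqs (t w)" (is "?L = ?R")
  proof
    show "?L \<subseteq> ?R"
    proof
      fix x assume "x \<in> ?L"
      then obtain F G where FG: "F \<in> fin_seqs (t w)" "G \<in> fin_seqs (t w)"
        and x: "x = mat_op p F + shift_summands k (mat_op q G)" by blast
      have "trunc k F + shift_summands k G \<in> fin_seqs (t w)"
        using w FG by (simp add: fibre_seq_mem)
      moreover have "mat_op p (shift_summands k G) = 0"
        using mat_op_trunc[OF p, of "shift_summands k G"] mem[OF FG(2)] matrices_infI[OF p] by simp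
      then have "x = mat_op (diag_sum R k p q) (trunc k F + shift_summands k G)"
        using mem[OF FG(1)] mem[OF FG(2)] matrices_infI[OF p] q
        by (simp add: x mat_op_diag_sum[OF p q] mat_op_trunc[OF p])
      ultimately show "x \<in> ?R" by blast
    qed
    show "?R \<subseteq> ?L"
    proof (rule image_subsetI)
      fix F assume F: "F \<in> fin_seqs (t w)"
      have "unshift k F \<in> fin_seqs (t w)" using w F by (simp add: fibre_seq_mem)
      then show "mat_op (diag_sum R k p q) F \<in> ?L"
        using F by (auto simp: mat_op_diag_sum[OF p q] mem)
    qed
  qed
  then show "{u + shift_summands k v | u v. u \<in> range_bundle p w \<and> v \<in> range_bundle q w}
      = mat_op (diag_sum R k p q) ` fin_seqs (t w)"
    using w by (simp add: range_bundle_def)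
qed

lemma subbundles_inf_eq: "subbundles_inf H t = range_bundle ` idempotents R"
proof
  show "subbundles_inf H t \<subseteq> range_bundle ` idempotents R"
    unfolding subbundles_inf_def by (auto elim!: subbundleE)
  show "range_bundle ` idempotents R \<subseteq> subbundles_inf H t"
  proof (rule image_subsetI)
    fix p assume p: "p \<in> idempotents R"
    obtain m where "p \<in> matrices R m" "1 \<le> m"
      using common_size[OF idempotents_matrices[OF p] idempotents_matrices[OF p]] by blast
    then show "range_bundle p \<in> subbundles_inf H t"
      unfolding subbundles_inf_def using range_bundle_subbundle[OF p] by auto
  qed
qed

lemma bundle_class:
  assumes "p \<in> idempotents R"
  shows "bundle_similar H t `` {range_bundle p} = range_bundle ` (alg_equiv R `` {p})"
proof
  show "bundle_similar H t `` {range_bundle p} \<subseteq> range_bundle ` (alg_equiv R `` {p})"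
  proof
    fix E assume "E \<in> bundle_similar H t `` {range_bundle p}"
    then have sim: "(range_bundle p, E) \<in> bundle_similar H t" by simp
    then obtain m where "E \<in> subbundles H t m" unfolding bundle_similar_def by blast
    then obtain q where "q \<in> idempotents R" "E = range_bundle q" by (rule subbundleE)
    then show "E \<in> range_bundle ` (alg_equiv R `` {p})"
      using similar_imp_alg_equiv assms sim by blast
  qed
  show "range_bundle ` (alg_equiv R `` {p}) \<subseteq> bundle_similar H t `` {range_bundle p}"
    using alg_equiv_imp_similar by blast
qed

lemma Vect_add_class:
  assumes p: "p \<in> idempotents R" and q: "q \<in> idempotents R" and k: "p \<in> matrices R k"
  shows "Vect_add R (alg_equiv R `` {p}) (alg_equiv R `` {q}) = alg_equiv R `` {diag_sum R k p q}"
proof -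
  have "alg_equiv R `` {diag_sum R k' p' q'} = alg_equiv R `` {diag_sum R k p q}"
    if "(p, p') \<in> alg_equiv R" "(q, q') \<in> alg_equiv R" "p' \<in> matrices R k'" for p' q' k'
    using equiv_class_eq[OF alg_equiv_equiv diag_sum_cong[OF that(1,2) k that(3)]] by simp
  moreover have "p \<in> alg_equiv R `` {p}" "q \<in> alg_equiv R `` {q}"
    using p q alg_equiv_equiv equiv_class_self by metis+
  ultimately show ?thesis
    unfolding Vect_add_def using k by blast
qed

text \<open>A sub-bundle of the \<open>k\<close>-th power in the class of the range bundle of \<open>p\<close> may be the range bundle of
  several idempotents. One of them has size \<open>k\<close>, as the sum of bundles requires, and it is still
  equivalent to \<open>p\<close>.\<close>

lemma Vect0_add_class:
  assumes p: "p \<in> idempotents R" and q: "q \<in> idempotents R"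
  shows "Vect0_add H t (range_bundle ` (alg_equiv R `` {p})) (range_bundle ` (alg_equiv R `` {q}))
    = range_bundle ` Vect_add R (alg_equiv R `` {p}) (alg_equiv R `` {q})" (is "?L = ?R")
proof -
  let ?X = "range_bundle ` (alg_equiv R `` {p})" and ?Y = "range_bundle ` (alg_equiv R `` {q})"
  have *: "bundle_similar H t `` {bundle_sum k E F} = ?R"
    if E: "E \<in> ?X" "E \<in> subbundles H t k" and F: "F \<in> ?Y" for E F k
  proof -
    obtain p1 where p1: "(p, p1) \<in> alg_equiv R" "E = range_bundle p1" using E(1) by blast
    obtain q' where q': "(q, q') \<in> alg_equiv R" "F = range_bundle q'" using F by blast
    obtain p' where p': "p' \<in> idempotents R" "p' \<in> matrices R k" "E = range_bundle p'"
      using E(2) by (rule subbundleE)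
    have p1_idem: "p1 \<in> idempotents R" and q'_idem: "q' \<in> idempotents R"
      using p1(1) q'(1) unfolding alg_equiv_def by blast+
    have "(p1, p') \<in> alg_equiv R"
      by (rule range_bundle_eqD[OF p1_idem p'(1)]) (simp flip: p1(2) p'(3))
    then have pp': "(p, p') \<in> alg_equiv R"
      using p1(1) alg_equiv_equiv unfolding equiv_def by (meson transD)
    have "bundle_similar H t `` {bundle_sum k E F} = range_bundle ` (alg_equiv R `` {diag_sum R k p' q'})"
      unfolding p'(3) q'(2) range_bundle_diag_sum[OF p'(2) idempotents_matrices[OF q'_idem]]
      by (rule bundle_class[OF diag_sum_idempotent[OF p'(1) q'_idem p'(2)]])
    also have "alg_equiv R `` {diag_sum R k p' q'} = Vect_add R (alg_equiv R `` {p'}) (alg_equiv R `` {q'})"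
      by (rule Vect_add_class[OF p'(1) q'_idem p'(2), symmetric])
    also have "alg_equiv R `` {p'} = alg_equiv R `` {p}"
      using equiv_class_eq[OF alg_equiv_equiv pp'] by simp
    also have "alg_equiv R `` {q'} = alg_equiv R `` {q}"
      using equiv_class_eq[OF alg_equiv_equiv q'(1)] by simp
    finally show ?thesis .
  qed
  obtain k where k: "p \<in> matrices R k" "1 \<le> k"
    using common_size[OF idempotents_matrices[OF p] idempotents_matrices[OF p]] by blast
  have mem: "range_bundle p \<in> ?X" "range_bundle q \<in> ?Y"
    using p q alg_equiv_equiv equiv_class_self by fast+
  have sub: "range_bundle p \<in> subbundles H t k"
    by (rule range_bundle_subbundle[OF p k(1)])
  show ?thesis
  proof
    show "?L \<subseteq> ?R"
      unfolding Vect0_add_def by (intro UN_least) (simp add: *)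
    show "?R \<subseteq> ?L"
      unfolding *[OF mem(1) sub mem(2), symmetric] Vect0_add_def
      using mem k(2) sub by (intro SUP_upper2[of "range_bundle p"] SUP_upper2[of "range_bundle q"]
          SUP_upper2[of k]) simp_all
  qed
qed

theorem K0_bundle_iso: "K0_bundle H t \<cong> K0_ring R"
proof -
  let ?f = "image range_bundle"
  have bij: "bij_betw ?f (Vect R) (Vect0 H t)"
  proof (rule bij_betw_imageI)
    show "inj_on ?f (Vect R)"
    proof (rule inj_onI)
      fix X Y assume X: "X \<in> Vect R" and Y: "Y \<in> Vect R" and eq: "?f X = ?f Y"
      obtain p where p: "p \<in> idempotents R" "X = alg_equiv R `` {p}"
        using X unfolding Vect_def by (rule quotientE)
      obtain q where q: "q \<in> idempotents R" "Y = alg_equiv R `` {q}"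
        using Y unfolding Vect_def by (rule quotientE)
      have "range_bundle p \<in> ?f X"
        using p equiv_class_self[OF alg_equiv_equiv p(1)] by blast
      then obtain q' where q': "(q, q') \<in> alg_equiv R" "range_bundle p = range_bundle q'"
        unfolding eq q(2) by blast
      then have "(p, q') \<in> alg_equiv R"
        using p(1) by (intro range_bundle_eqD) (auto simp: alg_equiv_def)
      then have "alg_equiv R `` {p} = alg_equiv R `` {q}"
        using q'(1) by (metis equiv_class_eq[OF alg_equiv_equiv])
      then show "X = Y" using p q by simp
    qed
    have "Vect0 H t = (\<lambda>p. bundle_similar H t `` {range_bundle p}) ` idempotents R"
      unfolding Vect0_def quotient_def subbundles_inf_eq by auto
    also have "\<dots> = (\<lambda>p. ?f (alg_equiv R `` {p})) ` idempotents R"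
      by (intro image_cong refl bundle_class)
    also have "\<dots> = ?f ` Vect R"
      unfolding Vect_def quotient_def by auto
    finally show "?f ` Vect R = Vect0 H t" by simp
  qed
  have closed: "Vect_add R X Y \<in> Vect R" and add: "?f (Vect_add R X Y) = Vect0_add H t (?f X) (?f Y)"
    if XY: "X \<in> Vect R" "Y \<in> Vect R" for X Y
  proof -
    obtain p where p: "p \<in> idempotents R" "X = alg_equiv R `` {p}"
      using XY(1) unfolding Vect_def by (rule quotientE)
    obtain q where q: "q \<in> idempotents R" "Y = alg_equiv R `` {q}"
      using XY(2) unfolding Vect_def by (rule quotientE)
    obtain k where k: "p \<in> matrices R k"
      using common_size[OF idempotents_matrices[OF p(1)] idempotents_matrices[OF p(1)]] by blast
    show "Vect_add R X Y \<in> Vect R"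
      unfolding p(2) q(2) Vect_add_class[OF p(1) q(1) k] Vect_def
      by (rule quotientI) (rule diag_sum_idempotent[OF p(1) q(1) k])
    show "?f (Vect_add R X Y) = Vect0_add H t (?f X) (?f Y)"
      unfolding p(2) q(2) by (rule Vect0_add_class[OF p(1) q(1), symmetric])
  qed
  \<comment> \<open>The isomorphism is transported along the inverse bijection, in the direction of the claim.\<close>
  let ?g = "inv_into (Vect R) ?f"
  have g: "?g E \<in> Vect R" "?f (?g E) = E" if "E \<in> Vect0 H t" for E
    using that bij by (auto simp: bij_betw_def inv_into_into f_inv_into_f)
  show ?thesis
    unfolding K0_bundle_def K0_ring_def
  proof (rule grothendieck_group_cong)
    show "bij_betw ?g (Vect0 H t) (Vect R)" by (rule bij_betw_inv_into[OF bij])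
    fix E F assume EF: "E \<in> Vect0 H t" "F \<in> Vect0 H t"
    have sum: "Vect0_add H t E F = ?f (Vect_add R (?g E) (?g F))"
      using add[of "?g E" "?g F"] g EF by simp
    then show "Vect0_add H t E F \<in> Vect0 H t"
      using closed[of "?g E" "?g F"] g EF bij by (auto simp: bij_betw_def)
    show "?g (Vect0_add H t E F) = Vect_add R (?g E) (?g F)"
      unfolding sum using closed[of "?g E" "?g F"] g EF bij
      by (intro inv_into_f_f) (auto simp: bij_betw_def)
  qed
qed

end

section \<open>Quasi-homogeneous curves\<close>

lemma in_summand_sum_apply:
  "(\<Sum>i\<in>I. fscale (c i) (in_summand i (f i))) (k, x) = (if k \<in> I then c k * f k x else 0)"
  if "finite I" for c :: "nat \<Rightarrow> complex"
proof -
  have "(\<Sum>i\<in>I. fscale (c i) (in_summand i (f i))) (k, x)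
      = (\<Sum>i\<in>I. fscale (c i) (in_summand i (f i)) (k, x))"
    using that by (induction I) simp_all
  also have "\<dots> = (\<Sum>i\<in>I. if k = i then c k * f k x else 0)"
    by (intro sum.cong) (auto simp: fscale_def in_summand_def)
  finally show ?thesis using that by simp
qed

text \<open>The component of \<open>\<gamma>\<^sub>j(w)\<close> in the summand \<open>j\<close> is an atom, with value 1 at 0, and the components
  beyond \<open>j\<close> vanish: the frame is triangular.\<close>

lemma qh_frame_at_0:
  assumes "\<And>i. i < n \<Longrightarrow> \<mu> i i = 1" "j < n" "j \<le> k"
  shows "qh_frame l0 L \<mu> j w (k, 0) = (if j = k then 1 else 0)"
  using assms by (simp add: qh_frame_def in_summand_sum_apply atom_deriv_def atom_def)

lemma qh_frame_independent:
  assumes diag: "\<And>i. i < n \<Longrightarrow> \<mu> i i = 1"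
  shows "cfun.independent ((\<lambda>j. qh_frame l0 L \<mu> j w) ` {..<n}) \<and>
    card ((\<lambda>j. qh_frame l0 L \<mu> j w) ` {..<n}) = n"
proof -
  let ?g = "\<lambda>j. qh_frame l0 L \<mu> j w"
  note at_0 = qh_frame_at_0[of n \<mu>, OF diag]
  have "cfun.independent (?g ` {..<m}) \<and> card (?g ` {..<m}) = m" if "m \<le> n" for m
    using that
  proof (induction m)
    case 0
    then show ?case by (simp add: cfun.independent_empty)
  next
    case (Suc m)
    \<comment> \<open>Evaluation at 0 in the summand \<open>m\<close> separates the next frame vector from the earlier ones.\<close>
    have "cfun.span (?g ` {..<m}) \<subseteq> {F. F (m, 0) = 0}"
      using Suc.prems
      by (intro cfun.span_minimal) (auto simp: at_0 cfun.subspace_def fscale_def)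
    moreover have "?g m (m, 0) = 1" using Suc.prems by (simp add: at_0)
    ultimately have new: "?g m \<notin> cfun.span (?g ` {..<m})" by auto
    then have "?g m \<notin> ?g ` {..<m}"
      by (rule contrapos_nn) (rule cfun.span_base)
    then show ?case
      using Suc new by (simp add: lessThan_Suc cfun.independent_insertI)
  qed
  then show ?thesis by blast
qed

text \<open>The dimension of an infinite-dimensional space is 0 by convention, so \<open>dim V > 0\<close> provides a finite
  basis of \<open>V\<close>, and an independent set cannot be larger than that.\<close>

lemma (in vector_space) span_eq_of_card_eq_dim:
  assumes V: "subspace V" and B: "independent B" "B \<subseteq> V" "finite B" "card B = dim V" "dim V > 0"
  shows "span B = V"
proof
  show "span B \<subseteq> V" using V B(2) by (rule span_minimal[rotated])
  obtain C where C: "C \<subseteq> V" "independent C" "V \<subseteq> span C" "card C = dim V"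
    by (rule basis_exists)
  then have "finite C" using B(5) card_ge_0_finite by metis
  show "V \<subseteq> span B"
  proof (rule ccontr)
    assume "\<not> V \<subseteq> span B"
    then obtain v where v: "v \<in> V" "v \<notin> span B" by blast
    then have "independent (insert v B)" using B(1) by (intro independent_insertI)
    moreover have "insert v B \<subseteq> span C" using v(1) B(2) C(3) by blast
    ultimately have "card (insert v B) \<le> card C"
      using independent_span_bound[OF \<open>finite C\<close>] by blast
    moreover have "v \<notin> B" using v(2) span_base by blast
    ultimately show False using B(3,4) C(4) by simp
  qed
qed

theorem theorem4p7:
  fixes n :: nat and l0 L :: real and \<mu> :: "nat \<Rightarrow> nat \<Rightarrow> complex"
    and Hs :: "nat \<Rightarrow> complex hspace"
    and T :: "(nat \<times> complex \<Rightarrow> complex) \<Rightarrow> (nat \<times> complex \<Rightarrow> complex)"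
  assumes "n \<ge> 2" and "l0 > 0" and "L > 0"
    and "\<And>i. i < n \<Longrightarrow> bergman_space (Hs i) (l0 + real i * L)"
    and "\<And>i. i < n \<Longrightarrow> \<mu> i i = 1"
    and "\<And>i. i + 1 < n \<Longrightarrow> \<mu> i (i + 1) \<noteq> 0"
    and "cowen_douglas n (dsum_space n Hs) T"
    and "\<And>j w. j < n \<Longrightarrow> w \<in> unit_disc \<Longrightarrow>
           qh_frame l0 L \<mu> j w \<in> eigenspace (dsum_space n Hs) T w"
  shows "K0_bundle (dsum_space n Hs) (qh_curve n l0 L \<mu>) \<cong>
         K0_ring (curve_algebra (dsum_space n Hs) (qh_curve n l0 L \<mu>))"
proof -
  let ?H = "dsum_space n Hs" and ?t = "qh_curve n l0 L \<mu>"
  have cd: "n \<ge> 1" "chilbert_space ?H" "T \<in> bounded_ops ?H"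
    "\<And>w. w \<in> unit_disc \<Longrightarrow> cfun.dim (eigenspace ?H T w) = n"
    "dense_in ?H (cfun.span (\<Union>w\<in>unit_disc. eigenspace ?H T w))"
    using assms(7) unfolding cowen_douglas_def by blast+
  interpret chilbert_space ?H by (rule cd(2))
  have T_add: "T (u + v) = T u + T v" if "u \<in> vec ?H" "v \<in> vec ?H" for u v
    using cd(3) that unfolding bounded_ops_def by blast
  have T_scale: "T (fscale c v) = fscale c (T v)" if "v \<in> vec ?H" for c v
    using cd(3) that unfolding bounded_ops_def by blast
  have subspace: "cfun.subspace (eigenspace ?H T w)" for w
  proof (rule cfun.subspaceI)
    have "T 0 = 0" using T_add[OF vec_0 vec_0] by simp
    then show "0 \<in> eigenspace ?H T w"
      by (simp add: eigenspace_def vec_0 cfun.scale_zero_right)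
    show "u + v \<in> eigenspace ?H T w" if "u \<in> eigenspace ?H T w" "v \<in> eigenspace ?H T w" for u v
      using that by (simp add: eigenspace_def vec_add T_add cfun.scale_right_distrib)
    show "fscale c v \<in> eigenspace ?H T w" if "v \<in> eigenspace ?H T w" for c v
      using that by (simp add: eigenspace_def vec_scale T_scale cfun.scale_left_commute)
  qed
  \<comment> \<open>The fibre is spanned by \<open>n\<close> independent eigenvectors in an \<open>n\<close>-dimensional eigenspace.\<close>
  have fibre: "?t w = eigenspace ?H T w" if w: "w \<in> unit_disc" for w
    unfolding qh_curve_def
  proof (rule cfun.span_eq_of_card_eq_dim)
    show "(\<lambda>j. qh_frame l0 L \<mu> j w) ` {..<n} \<subseteq> eigenspace ?H T w"
      using assms(8) w by blast
  qed (use qh_frame_independent[of n \<mu>, OF assms(5)] subspace cd(1) cd(4)[OF w] in auto)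
  have "spanning_curve ?H ?t"
  proof (intro spanning_curve.intro spanning_curve_axioms.intro)
    show "chilbert_space ?H" by (rule cd(2))
    show "cfun.subspace (?t w)" if "w \<in> unit_disc" for w
      by (simp only: fibre[OF that] subspace)
    show "?t w \<subseteq> vec ?H" if "w \<in> unit_disc" for w
      unfolding fibre[OF that] eigenspace_def by blast
    have "(\<Union>w\<in>unit_disc. ?t w) = (\<Union>w\<in>unit_disc. eigenspace ?H T w)"
      by (rule SUP_cong[OF refl fibre])
    then show "dense_in ?H (cfun.span (\<Union>w\<in>unit_disc. ?t w))"
      using cd(5) by (simp only:)
  qed
  then show ?thesis by (rule spanning_curve.K0_bundle_iso)
qed

end
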